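(* For each fixed $m$, the random vectors $(\widehat{\Lambda}^\tau_0,\widehat{\Lambda}^\tau_1,\dots,\widehat{\Lambda}^\tau_m)$ converge almost surely, as $\tau\downarrow 0$, to a random vector $(\widehat{\Lambda}_0,\widehat{\Lambda}_1,\dots,\widehat{\Lambda}_m)$. The latter is the (initial segment of the) jump process $(\widehat{\Lambda}_j)_{j\ge 0}$ of the process $\lambda(t)$ viewed backward from time $t=\infty$, and $(\widehat{\Lambda}_j)_{j\ge0}$ is a Markov chain which starts at $\widehat{\Lambda}_0=\varnothing$ and has stationary transition probabilities (from $\mu$ to $\lambda$) $$\widehat{p}_{\mu,\lambda}=\begin{cases}\dfrac{\kappa\, g(n+\kappa r)}{(n+\kappa r)\,g(n)}, & \text{if } C_\kappa(\lambda)=C_\kappa(\mu)+r \text{ for some integers }\kappa,r\ge 1\text{ and } C_k(\lambda)=C_k(\mu)\text{ for all }k\ne\kappa,\\[1ex] 0,&\text{otherwise,}\end{cases}$$ where $n=N(\mu)$ is the weight of the partition $\mu$.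
   Context: A partition $\lambda=(\lambda_1,\lambda_2,\dots)$ of an integer $n\ge0$ is a non-increasing, eventually zero sequence of non-negative integers with sum $n$; $N(\lambda)=\sum_j\lambda_j$ is its weight, and $C_k(\lambda)=\#\{j:\lambda_j=k\}$, $k\ge1$, are its part counts, which determine $\lambda$. $\varnothing$ is the empty partition of $0$. Let $(\varepsilon_{k,j})_{k,j\ge1}$ be independent standard (mean 1) exponential random variables on a probability space $(\Omega,\mathcal F,\mathbb P)$. For $t>0$ let $\rho_k(t)=\inf\{r\ge0:\varepsilon_{k,r+1}\le kt\}$, and $\rho_k(\infty)=0$. For $t\in(0,\infty]$ let $\lambda(t)$ be the random partition with $C_k(\lambda(t))=\rho_k(t)$ for all $k\ge1$ (almost surely well defined for all $t$; $\lambda(\infty)=\varnothing$). Each $\rho_k$ is non-increasing and right-continuous in $t$. For $\tau>0$ let $\Lambda^\tau_0=\lambda(\tau),\Lambda^\tau_1,\dots,\Lambda^\tau_{J(\tau)}=\varnothing$ be the jump chain of $(\lambda(t))_{t\ge\tau}$, i.e. its successive distinct values, $J(\tau)$ being the random number of jumps until $\varnothing$ is reached. Let $\widehat{\Lambda}^\tau_j=\Lambda^\tau_{J(\tau)-j}$ for $0\le j\le J(\tau)$ and $\widehat{\Lambda}^\tau_j=\widehat{\Lambda}^\tau_{J(\tau)}$ for $j>J(\tau)$. The jump process of $\lambda(t)$ viewed backward from $t=\infty$ is defined by $\widehat{\Lambda}_0=\lambda(\infty)=\varnothing$ and, recursively, $T_j=\inf\{t:\lambda(t)=\widehat{\Lambda}_j\}$,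 $\widehat{\Lambda}_{j+1}=\lambda(T_j-0)$ (left limit at $T_j$). For a partition $\lambda$ of $n$, $g(n)=\lim_{\tau\downarrow0}\mathbb P[\exists t\ge\tau:\lambda(t)=\lambda]$ is the probability that the process $(\lambda(t))_{t>0}$ visits $\lambda$; it depends only on $n$. One has $g(0)=1$ and, for $n\ge1$, $$g(n)=\sum_{k=-\infty}^\infty\frac{(-1)^k n}{n+\frac{k(3k+1)}2}=\frac{8\sqrt3\,\pi n\,\sinh\left(\frac{\pi\sqrt{24n-1}}6\right)}{\sqrt{24n-1}\left(2\cosh\left(\frac{\pi\sqrt{24n-1}}3\right)-1\right)}.$$ *)

theory Defs
  imports "HOL-Probability.Probability"
begin

text \<open>Partitions are non-increasing, eventually zero sequences. The sequences are indexed
  from 0, so \<open>parts p j\<close> is the part usually written with index \<open>j + 1\<close>.\<close>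

typedef int_partition =
  "{p :: nat \<Rightarrow> nat. antimono p \<and> (\<forall>\<^sub>F j in sequentially. p j = 0)}"
  morphisms parts Abs_int_partition
  by (rule exI[of _ "\<lambda>_. 0"]) (auto simp: antimono_def)

definition empty_partition :: int_partition where
  "empty_partition = Abs_int_partition (\<lambda>_. 0)"

definition weight :: "int_partition \<Rightarrow> nat" where
  "weight p = (\<Sum>j. parts p j)"

text \<open>Only meaningful for \<open>k \<ge> 1\<close>, where the set below is finite.\<close>

definition part_count :: "nat \<Rightarrow> int_partition \<Rightarrow> nat" where
  "part_count k p = card {j. parts p j = k}"

text \<open>Time is \<open>ereal\<close>-valued, only \<open>0 < t \<le> \<infinity>\<close> being relevant. The infimum is taken in \<open>enat\<close>,
  so it is \<open>\<infinity>\<close> if no \<open>r\<close> qualifies. At \<open>t = \<infinity>\<close> and \<open>k \<ge> 1\<close> every \<open>r\<close> qualifies, which gives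
  \<open>rho \<epsilon> k \<infinity> \<omega> = 0\<close>.\<close>

definition rho :: "(nat \<Rightarrow> nat \<Rightarrow> 'a \<Rightarrow> real) \<Rightarrow> nat \<Rightarrow> ereal \<Rightarrow> 'a \<Rightarrow> enat" where
  "rho \<epsilon> k t \<omega> = (INF r \<in> {r :: nat. ereal (\<epsilon> k (r + 1) \<omega>) \<le> ereal (real k) * t}. enat r)"

text \<open>The random partition is only almost surely well defined (simultaneously for all times);
  off that event the whole path is set to the empty partition.\<close>

definition lam :: "(nat \<Rightarrow> nat \<Rightarrow> 'a \<Rightarrow> real) \<Rightarrow> 'a \<Rightarrow> ereal \<Rightarrow> int_partition" where
  "lam \<epsilon> \<omega> t =
     (if \<forall>s>0. \<exists>p. \<forall>k\<ge>1. enat (part_count k p) = rho \<epsilon> k s \<omega>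
      then THE p. \<forall>k\<ge>1. enat (part_count k p) = rho \<epsilon> k t \<omega>
      else empty_partition)"

text \<open>The jump chain of a right-continuous step path started at time \<open>\<tau>\<close>. When there is no
  further jump, the next jump time is \<open>Inf {} = \<infinity>\<close>.\<close>

primrec jump_time :: "(ereal \<Rightarrow> int_partition) \<Rightarrow> ereal \<Rightarrow> nat \<Rightarrow> ereal" where
  "jump_time f \<tau> 0 = \<tau>"
| "jump_time f \<tau> (Suc i) = Inf {t. jump_time f \<tau> i < t \<and> f t \<noteq> f (jump_time f \<tau> i)}"

definition jump_chain :: "(ereal \<Rightarrow> int_partition) \<Rightarrow> ereal \<Rightarrow> nat \<Rightarrow> int_partition" where
  "jump_chain f \<tau> i = f (jump_time f \<tau> i)"

definition num_jumps :: "(ereal \<Rightarrow> int_partition) \<Rightarrow> ereal \<Rightarrow> nat" where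
  "num_jumps f \<tau> = (LEAST i. jump_chain f \<tau> i = empty_partition)"

definition reversed_chain :: "(ereal \<Rightarrow> int_partition) \<Rightarrow> ereal \<Rightarrow> nat \<Rightarrow> int_partition" where
  "reversed_chain f \<tau> j = jump_chain f \<tau> (num_jumps f \<tau> - min j (num_jumps f \<tau>))"

text \<open>Left limits are with respect to the discrete topology on partitions, and times are
  restricted to \<open>s > 0\<close>.\<close>

definition left_limit :: "(ereal \<Rightarrow> int_partition) \<Rightarrow> ereal \<Rightarrow> int_partition" where
  "left_limit f t = (THE p. \<forall>\<^sub>F s in at t within {0<..<t}. f s = p)"

primrec backward_chain :: "(ereal \<Rightarrow> int_partition) \<Rightarrow> nat \<Rightarrow> int_partition" where
  "backward_chain f 0 = f \<infinity>"
| "backward_chain f (Suc j) = left_limit f (Inf {t. 0 < t \<and> f t = backward_chain f j})"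

text \<open>The limit defining the visit probability is the same for all partitions of \<open>n\<close>; the
  definition refers to this common value.\<close>

definition visit_prob :: "'a measure \<Rightarrow> (nat \<Rightarrow> nat \<Rightarrow> 'a \<Rightarrow> real) \<Rightarrow> nat \<Rightarrow> real" where
  "visit_prob M \<epsilon> n = (THE x. \<forall>p. weight p = n \<longrightarrow>
     ((\<lambda>\<tau>::real. measure M {\<omega> \<in> space M. \<exists>t\<ge>ereal \<tau>. lam \<epsilon> \<omega> t = p}) \<longlongrightarrow> x) (at_right 0))"

definition adds_parts :: "nat \<Rightarrow> nat \<Rightarrow> int_partition \<Rightarrow> int_partition \<Rightarrow> bool" where
  "adds_parts \<kappa> r \<mu> p \<longleftrightarrow> \<kappa> \<ge> 1 \<and> r \<ge> 1 \<and> part_count \<kappa> p = part_count \<kappa> \<mu> + r \<and>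
     (\<forall>k\<ge>1. k \<noteq> \<kappa> \<longrightarrow> part_count k p = part_count k \<mu>)"

text \<open>The pair \<open>(\<kappa>, r)\<close> is determined by the two partitions.\<close>

definition backward_trans :: "(nat \<Rightarrow> real) \<Rightarrow> int_partition \<Rightarrow> int_partition \<Rightarrow> real" where
  "backward_trans g \<mu> p =
     (if \<exists>\<kappa> r. adds_parts \<kappa> r \<mu> p
      then let n = weight \<mu>; (\<kappa>, r) = (THE (\<kappa>, r). adds_parts \<kappa> r \<mu> p)
           in real \<kappa> * g (n + \<kappa> * r) / (real (n + \<kappa> * r) * g n)
      else 0)"

text \<open>Time-homogeneous Markov chain with discrete state space, initial state \<open>x0\<close> and
  (stochastic) transition matrix \<open>P\<close>.\<close>

definition markov_chain ::
  "'a measure \<Rightarrow> (nat \<Rightarrow> 'a \<Rightarrow> 's) \<Rightarrow> 's \<Rightarrow> ('s \<Rightarrow> 's \<Rightarrow> real) \<Rightarrow> bool" where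
  "markov_chain M X x0 P \<longleftrightarrow>
     (\<forall>x y. 0 \<le> P x y) \<and> (\<forall>x. (P x has_sum 1) UNIV) \<and>
     (\<forall>j. X j \<in> M \<rightarrow>\<^sub>M count_space UNIV) \<and>
     (AE \<omega> in M. X 0 \<omega> = x0) \<and>
     (\<forall>j x y. measure M {\<omega> \<in> space M. \<forall>i\<le>j. X i \<omega> = x i} > 0 \<longrightarrow>
        cond_prob M (\<lambda>\<omega>. X (Suc j) \<omega> = y) (\<lambda>\<omega>. \<forall>i\<le>j. X i \<omega> = x i) = P (x j) y)"

end

theory Submission
  imports Defs
begin

text \<open>
Write \<open>X (k, l) = \<epsilon> k l / k\<close>. These are independent exponential clocks, the rate of \<open>X (k, l)\<close> being
\<open>k\<close>. At time \<open>t\<close> the number of parts of size \<open>k\<close> is the least \<open>c\<close> such that the clock of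
\<open>(k, c + 1)\<close> has rung. Hence \<open>\<lambda>(t) = p\<close> iff the clocks of \<open>(k, C\<^sub>k(p) + 1)\<close> have rung for all \<open>k\<close>, while
none of the clocks of \<open>(k, l)\<close> with \<open>1 \<le> l \<le> C\<^sub>k(p)\<close>, the copies of \<open>p\<close>, has rung (\<open>lam_eq_iff\<close>). The
rates of the copies of \<open>p\<close> sum up to the weight \<open>N(p)\<close>.

The statement about convergence is deterministic. The path is a right-continuous step function whose
weight decreases strictly at each jump. So every jump chain runs through the visited values in order
of decreasing weight, and the backward chain runs through them in order of increasing weight.
The first \<open>m\<close> steps agree as soon as the jump chain has at least \<open>m\<close> jumps, which is the case for small
\<open>\<tau>\<close> because the path is almost surely unbounded near time \<open>0\<close> (\<open>reversed_chain_limit\<close>).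

For the Markov property, let \<open>S\<close> be the supremum over \<open>k\<close> of the clocks of \<open>(k, C\<^sub>k(p) + 1)\<close>. Almost
surely, \<open>p\<close> is visited iff \<open>S\<close> is less than the clocks of all copies of \<open>p\<close> (\<open>visits_lam_iff\<close>). If
\<open>(k, l)\<close> is the copy of \<open>p\<close> that rings first, then the next value of the process has \<open>l - 1\<close> parts of
size \<open>k\<close> and otherwise the same part counts as \<open>p\<close>, so that \<open>p\<close> arises from it by adding parts of
size \<open>k\<close> (\<open>preceded_by_iff_rings_first\<close>). Consider partitions \<open>x 0, \<dots>, x j\<close> where \<open>x (i + 1)\<close>
arises from \<open>x i\<close> by adding parts of size \<open>\<kappa> i\<close>. The memoryless property gives, by induction on \<open>j\<close>,
that with probability \<open>(\<Prod>i<j. \<kappa> i / N(x (i + 1))) * exp (- s * N(x j))\<close> all copies of \<open>x j\<close> ring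
after time \<open>s\<close> and do so in an order that leads from \<open>x j\<close> through \<open>x (j - 1), \<dots>\<close> to \<open>x 0\<close>
(\<open>prob_clocks_gt_races\<close>). For \<open>p = x j\<close> the variable \<open>S\<close> is independent of the clocks of the copies, and
its law does not depend on \<open>p\<close>. Integration over the values \<open>s\<close> of \<open>S\<close> shows that the process runs through
\<open>x j, \<dots>, x 0\<close> with probability \<open>(\<Prod>i<j. \<kappa> i / N(x (i + 1))) * g(N(x j))\<close>, where
\<open>g(n) = E exp (- n * S)\<close> is the probability of visiting a given partition of \<open>n\<close>
(\<open>prob_visits_races\<close>). The transition probabilities of the backward chain are quotients of such numbers.
They sum up to \<open>1\<close> because almost surely every visited partition has a predecessor.
\<close>

section \<open>Partitions and their part counts\<close>

lemma parts_antimono: "i \<le> j \<Longrightarrow> parts p j \<le> parts p i"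
  using parts[of p] by (auto simp: antimono_def)

lemma parts_bounded_support: "\<exists>L. \<forall>j. parts p j \<noteq> 0 \<longrightarrow> j < L"
proof -
  obtain L where "\<forall>j\<ge>L. parts p j = 0"
    using parts[of p] by (auto simp: eventually_sequentially)
  then have "\<forall>j. parts p j \<noteq> 0 \<longrightarrow> j < L" by (metis not_le)
  then show ?thesis by blast
qed

lemma finite_parts_eq: "k \<ge> 1 \<Longrightarrow> finite {j. parts p j = k}"
proof -
  assume k: "k \<ge> 1"
  obtain L where L: "\<forall>j. parts p j \<noteq> 0 \<longrightarrow> j < L" using parts_bounded_support[of p] ..
  have "{j. parts p j = k} \<subseteq> {..<L}" using L k by auto
  then show ?thesis by (rule finite_subset) simp
qed

lemma part_count_gt_first:
  assumes "k > parts p 0" shows "part_count k p = 0"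
proof -
  have "{j. parts p j = k} = {}" using parts_antimono[of 0 _ p] assms leD by fastforce
  then show ?thesis by (simp add: part_count_def)
qed

text \<open>The parts of a partition, labelled by pairs: the pair \<open>(k, l)\<close> stands for the \<open>l\<close>-th part
  of size \<open>k\<close>.\<close>

definition copies :: "int_partition \<Rightarrow> (nat \<times> nat) set" where
  "copies p = (SIGMA k:{1..}. {1..part_count k p})"

lemma mem_copies [simp]: "(k, l) \<in> copies p \<longleftrightarrow> 1 \<le> k \<and> 1 \<le> l \<and> l \<le> part_count k p"
  by (auto simp: copies_def)

lemma copies_altdef: "copies p = (SIGMA k:{1..parts p 0}. {1..part_count k p})"
proof -
  have "k \<le> parts p 0" if "1 \<le> l" "l \<le> part_count k p" for k l
    using part_count_gt_first[of p k] that by (cases "k \<le> parts p 0") auto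
  then show ?thesis by (auto simp: copies_def)
qed

lemma finite_copies [simp, intro]: "finite (copies p)"
  by (simp add: copies_altdef)

lemma weight_eq_sum_copies: "weight p = (\<Sum>b\<in>copies p. fst b)"
proof -
  obtain L where L: "\<forall>j. parts p j \<noteq> 0 \<longrightarrow> j < L" using parts_bounded_support[of p] ..
  have "weight p = (\<Sum>j<L. parts p j)"
    unfolding weight_def by (rule suminf_finite) (use L in auto)
  also have "\<dots> = (\<Sum>j\<in>{j\<in>{..<L}. parts p j \<ge> 1}. parts p j)"
    by (rule sum.mono_neutral_right) auto
  also have "\<dots> = (\<Sum>k=1..parts p 0. \<Sum>j\<in>{j\<in>{j\<in>{..<L}. parts p j \<ge> 1}. parts p j = k}. parts p j)"
    by (rule sum.group[symmetric]) (auto intro: parts_antimono)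
  also have "\<dots> = (\<Sum>k=1..parts p 0. k * part_count k p)"
  proof (rule sum.cong[OF refl])
    fix k assume k: "k \<in> {1..parts p 0}"
    have "{j\<in>{j\<in>{..<L}. parts p j \<ge> 1}. parts p j = k} = {j. parts p j = k}"
      using L k by auto
    then show "(\<Sum>j\<in>{j\<in>{j\<in>{..<L}. parts p j \<ge> 1}. parts p j = k}. parts p j) = k * part_count k p"
      by (simp add: part_count_def)
  qed
  also have "\<dots> = (\<Sum>k=1..parts p 0. \<Sum>l=1..part_count k p. k)" by (simp add: mult.commute)
  also have "\<dots> = (\<Sum>b\<in>copies p. fst b)"
    by (subst sum.Sigma) (auto simp: copies_altdef split_def)
  finally show ?thesis .
qed

text \<open>The number of parts of size at least \<open>m\<close> is a sum of part counts, and it determines which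
  entries of the sequence are at least \<open>m\<close>, because these form an initial segment.\<close>

lemma part_count_inject:
  assumes eq: "\<And>k. k \<ge> 1 \<Longrightarrow> part_count k p = part_count k q"
  shows "p = q"
proof -
  define K where "K = max (parts p 0) (parts q 0)"
  have le: "m \<le> parts r j \<longleftrightarrow> j < (\<Sum>k=m..K. part_count k r)"
    if m: "m \<ge> 1" and r: "r \<in> {p, q}" for m j r
  proof -
    obtain L where L: "\<forall>j. parts r j \<noteq> 0 \<longrightarrow> j < L" using parts_bounded_support[of r] ..
    have fin: "finite {j. m \<le> parts r j}"
      by (rule finite_subset[of _ "{..<L}"]) (use L m in auto)
    have "parts r i \<le> K" for i
      using parts_antimono[of 0 i r] r by (auto simp: K_def)
    then have "{j. m \<le> parts r j} = (\<Union>k\<in>{m..K}. {j. parts r j = k})" by auto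
    then have "card {j. m \<le> parts r j} = (\<Sum>k=m..K. part_count k r)"
      unfolding part_count_def using m
      by (simp only:) (rule card_UN_disjoint, auto intro: finite_parts_eq)
    moreover have "{j. m \<le> parts r j} = {..<card {j. m \<le> parts r j}}"
    proof -
      define N where "N = (LEAST j. \<not> m \<le> parts r j)"
      have N: "\<not> m \<le> parts r N"
        unfolding N_def by (rule LeastI[of _ L]) (use L[rule_format, of L] m in auto)
      have "{j. m \<le> parts r j} = {..<N}"
      proof (intro set_eqI iffI)
        fix j assume "j \<in> {j. m \<le> parts r j}"
        then show "j \<in> {..<N}" using N parts_antimono[of N j r] by (cases "N \<le> j") auto
      next
        fix j assume "j \<in> {..<N}"
        then have "\<not> \<not> m \<le> parts r j" unfolding N_def by (intro not_less_Least) simp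
        then show "j \<in> {j. m \<le> parts r j}" by simp
      qed
      then show ?thesis by simp
    qed
    ultimately show ?thesis by (metis lessThan_iff mem_Collect_eq)
  qed
  have "m \<le> parts p j \<longleftrightarrow> m \<le> parts q j" for m j
    using le[of m p j] le[of m q j] eq by (cases "m = 0") auto
  then have "parts p = parts q" by (auto simp: fun_eq_iff intro: antisym)
  then show ?thesis by (simp add: parts_inject)
qed

lemma part_count_eq_card_copies: "k \<ge> 1 \<Longrightarrow> part_count k p = card (copies p \<inter> {k} \<times> UNIV)"
proof -
  assume "k \<ge> 1"
  then have "copies p \<inter> {k} \<times> UNIV = {k} \<times> {1..part_count k p}" by auto
  then show ?thesis by (simp add: card_cartesian_product)
qed

lemma copies_inject: "copies p = copies q \<Longrightarrow> p = q"
  by (rule part_count_inject) (simp add: part_count_eq_card_copies)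

lemma copies_mono:
  "(\<And>k. k \<ge> 1 \<Longrightarrow> part_count k p \<le> part_count k q) \<Longrightarrow> copies p \<subseteq> copies q"
  by (force dest: order_trans)

lemma weight_mono: "copies p \<subseteq> copies q \<Longrightarrow> weight p \<le> weight q"
  unfolding weight_eq_sum_copies by (rule sum_mono2) auto

lemma copies_subset_weight_eq:
  assumes "copies p \<subseteq> copies q" "weight p = weight q" shows "p = q"
proof (rule copies_inject, rule ccontr)
  assume "copies p \<noteq> copies q"
  then obtain b where b: "b \<in> copies q - copies p" using assms(1) by blast
  then have "0 < fst b" by (cases b) auto
  then have "(\<Sum>b\<in>copies p. fst b) < (\<Sum>b\<in>copies q. fst b)"
    using assms(1) b by (intro sum_strict_mono2[of _ _ b]) auto
  then show False using assms(2) by (simp add: weight_eq_sum_copies)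
qed

lemma part_count_empty [simp]: "k \<ge> 1 \<Longrightarrow> part_count k empty_partition = 0"
  by (simp add: part_count_def empty_partition_def Abs_int_partition_inverse antimono_def)

lemma copies_empty [simp]: "copies empty_partition = {}"
  by (auto simp: copies_def)

lemma weight_empty [simp]: "weight empty_partition = 0"
  by (simp add: weight_eq_sum_copies)

lemma weight_eq_0_iff: "weight p = 0 \<longleftrightarrow> p = empty_partition"
  using copies_subset_weight_eq[of empty_partition p] by auto

lemma part_counts_exist:
  assumes fin: "finite {k. k \<ge> 1 \<and> c k \<noteq> 0}"
  shows "\<exists>p. \<forall>k\<ge>1. part_count k p = c k"
proof -
  define c' where "c' k = (if k \<ge> 1 then c k else 0)" for k
  define A where "A = Abs_multiset c'"
  have "{k. 0 < c' k} = {k. k \<ge> 1 \<and> c k \<noteq> 0}" by (auto simp: c'_def)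
  then have A: "count A = c'" using fin by (simp add: A_def)
  define xs where "xs = rev (sorted_list_of_multiset A)"
  have sorted: "sorted_wrt (\<ge>) xs" by (simp add: xs_def sorted_wrt_rev)
  have mset: "mset xs = A" by (simp add: xs_def)
  define p where "p = Abs_int_partition (\<lambda>j. if j < length xs then xs ! j else 0)"
  have "xs ! j \<le> xs ! i" if "i \<le> j" "j < length xs" for i j
    using sorted that by (cases "i = j") (auto simp: sorted_wrt_iff_nth_less)
  then have "antimono (\<lambda>j. if j < length xs then xs ! j else 0)"
    by (auto simp: antimono_def)
  then have p: "parts p = (\<lambda>j. if j < length xs then xs ! j else 0)"
    unfolding p_def
    by (intro Abs_int_partition_inverse) (auto simp: eventually_sequentially intro!: exI[of _ "length xs"])
  have "part_count k p = c k" if k: "k \<ge> 1" for k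
  proof -
    have "{j. parts p j = k} = {j. j < length xs \<and> k = xs ! j}" using k by (auto simp: p)
    then have "part_count k p = length (filter ((=) k) xs)"
      by (simp add: part_count_def length_filter_conv_card)
    then have "part_count k p = count (mset xs) k"
      by (simp only: count_mset count_list_eq_length_filter)
    then show ?thesis using k by (simp add: mset A c'_def)
  qed
  then show ?thesis by blast
qed

lemma finite_part_counts: "finite {k. k \<ge> 1 \<and> part_count k p \<noteq> 0}"
  by (rule finite_subset[of _ "{..parts p 0}"])
     (use part_count_gt_first[of p] in \<open>auto intro: leI\<close>)

instance int_partition :: countable
proof (rule countable_classI)
  fix p q :: int_partition
  define len where "len p = (LEAST L. \<forall>j\<ge>L. parts p j = 0)" for p
  assume "to_nat (map (parts p) [0..<LEAST L. \<forall>j\<ge>L. parts p j = 0]) =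
          to_nat (map (parts q) [0..<LEAST L. \<forall>j\<ge>L. parts q j = 0])"
  then have eq: "map (parts p) [0..<len p] = map (parts q) [0..<len q]" by (simp add: len_def)
  have len: "parts r j = 0" if "j \<ge> len r" for r j
  proof -
    have "\<forall>j\<ge>len r. parts r j = 0"
    proof -
      obtain L where "\<forall>j. parts r j \<noteq> 0 \<longrightarrow> j < L" using parts_bounded_support[of r] ..
      then have "\<forall>j\<ge>L. parts r j = 0" by (meson not_le)
      then show ?thesis unfolding len_def by (rule LeastI)
    qed
    then show ?thesis using that by blast
  qed
  have nth: "parts r j = (if j < length (map (parts r) [0..<len r]) then map (parts r) [0..<len r] ! j else 0)"
    for r j using len[of r j] by simp
  have "parts p = parts q" by (rule ext) (subst (1 2) nth, simp only: eq)
  then show "p = q" by (simp add: parts_inject)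
qed

text \<open>The label of the first part that is added when parts of size \<open>\<kappa>\<close> are added to \<open>\<mu>\<close>.\<close>

definition first_new :: "nat \<Rightarrow> int_partition \<Rightarrow> nat \<times> nat" where
  "first_new \<kappa> \<mu> = (\<kappa>, Suc (part_count \<kappa> \<mu>))"

lemma copies_adds_parts:
  assumes "adds_parts \<kappa> r \<mu> p"
  shows "copies p = copies \<mu> \<union> {\<kappa>} \<times> {Suc (part_count \<kappa> \<mu>)..part_count \<kappa> \<mu> + r}"
proof -
  have "b \<in> copies p \<longleftrightarrow> b \<in> copies \<mu> \<union> {\<kappa>} \<times> {Suc (part_count \<kappa> \<mu>)..part_count \<kappa> \<mu> + r}" for b
    using assms by (cases b, cases "fst b = \<kappa>") (auto simp: adds_parts_def)
  then show ?thesis by blast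
qed

lemma weight_adds_parts: "adds_parts \<kappa> r \<mu> p \<Longrightarrow> weight p = weight \<mu> + \<kappa> * r"
proof -
  assume a: "adds_parts \<kappa> r \<mu> p"
  let ?N = "{\<kappa>} \<times> {Suc (part_count \<kappa> \<mu>)..part_count \<kappa> \<mu> + r}"
  have "weight p = (\<Sum>b\<in>copies \<mu>. fst b) + (\<Sum>b\<in>?N. fst b)"
    unfolding weight_eq_sum_copies copies_adds_parts[OF a]
    by (rule sum.union_disjoint) auto
  also have "(\<Sum>b\<in>?N. fst b) = (\<Sum>b\<in>?N. \<kappa>)" by (rule sum.cong) auto
  finally show ?thesis by (simp add: weight_eq_sum_copies mult.commute)
qed

lemma adds_parts_unique:
  assumes "adds_parts \<kappa> r \<mu> p" "adds_parts \<kappa>' r' \<mu> p"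
  shows "\<kappa>' = \<kappa>" "r' = r"
proof -
  show "\<kappa>' = \<kappa>" using assms unfolding adds_parts_def
    by (metis add_cancel_right_right not_one_le_zero)
  then show "r' = r" using assms unfolding adds_parts_def by simp
qed

lemma first_new_in_copies: "adds_parts \<kappa> r \<mu> p \<Longrightarrow> first_new \<kappa> \<mu> \<in> copies p"
  by (auto simp: first_new_def adds_parts_def)

section \<open>Step paths and their jump chains\<close>

text \<open>The deterministic properties of the paths on which the behaviour of the jump chains depends.
  Distinct values of such a path have distinct weights, so the order of the values in time is the
  reversed order of their weights. A path that is constantly empty is included.\<close>

locale step_path =
  fixes f :: "ereal \<Rightarrow> int_partition"
  assumes at_infty: "f \<infinity> = empty_partition"
    and weight_antimono: "0 < s \<Longrightarrow> s \<le> t \<Longrightarrow> weight (f t) \<le> weight (f s)"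
    and weight_inj: "0 < s \<Longrightarrow> 0 < t \<Longrightarrow> weight (f s) = weight (f t) \<Longrightarrow> f s = f t"
    and right_constant: "0 < t \<Longrightarrow> t < \<infinity> \<Longrightarrow> \<exists>u>t. \<forall>s. t \<le> s \<and> s < u \<longrightarrow> f s = f t"
    and eventually_empty: "\<exists>t. 0 < t \<and> t < \<infinity> \<and> f t = empty_partition"

text \<open>Visits at time \<open>\<infinity>\<close> are included.\<close>

definition visits :: "(ereal \<Rightarrow> int_partition) \<Rightarrow> int_partition \<Rightarrow> bool" where
  "visits f p \<longleftrightarrow> (\<exists>t>0. f t = p)"

text \<open>For a step path: the value \<open>q\<close> is taken immediately before the value \<open>p\<close>. This is expressed by
  the weights, without reference to time.\<close>

definition preceded_by :: "(ereal \<Rightarrow> int_partition) \<Rightarrow> int_partition \<Rightarrow> int_partition \<Rightarrow> bool" where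
  "preceded_by f p q \<longleftrightarrow> visits f p \<and> visits f q \<and> weight p < weight q \<and>
     (\<forall>v. visits f v \<longrightarrow> \<not> (weight p < weight v \<and> weight v < weight q))"

lemma left_limit_eqI:
  assumes "a < t" "0 < t" and eq: "\<And>s. a < s \<Longrightarrow> s < t \<Longrightarrow> 0 < s \<Longrightarrow> f s = p"
  shows "left_limit f t = p"
proof -
  have 1: "\<forall>\<^sub>F s in at t within {0<..<t}. f s = p"
    unfolding eventually_at_topological
    by (rule exI[of _ "{a<..}"]) (use assms in auto)
  have nt: "at t within {0<..<t} \<noteq> bot"
  proof
    assume "at t within {0<..<t} = bot"
    then have "\<forall>\<^sub>F s in at t within {0<..<t}. False" by simp
    then obtain S where S: "open S" "t \<in> S" "\<And>s. s \<in> S \<Longrightarrow> s \<noteq> t \<Longrightarrow> s \<notin> {0<..<t}"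
      unfolding eventually_at_topological by blast
    obtain b where b: "b < t" "{b<..t} \<subseteq> S" using open_left[OF S(1,2) \<open>0 < t\<close>] by blast
    obtain s where "max b 0 < s" "s < t"
      using dense[of "max b 0" t] b(1) \<open>0 < t\<close> by auto
    then have "s \<in> {b<..t}" "s \<noteq> t" "s \<in> {0<..<t}" by auto
    then show False using S(3)[of s] b(2) by blast
  qed
  show ?thesis
    unfolding left_limit_def
  proof (rule the_equality)
    show "\<forall>\<^sub>F s in at t within {0<..<t}. f s = p" by (rule 1)
  next
    fix q assume "\<forall>\<^sub>F s in at t within {0<..<t}. f s = q"
    with 1 have "\<forall>\<^sub>F s in at t within {0<..<t}. p = q" by eventually_elim simp
    with nt show "q = p" by simp
  qed
qed

context step_path
begin

lemma visits_at [simp, intro]: "0 < t \<Longrightarrow> visits f (f t)"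
  by (auto simp: visits_def)

lemma visits_empty [simp]: "visits f empty_partition"
  using visits_at[of \<infinity>] by (simp add: at_infty)

lemma visits_weight_eq: "visits f p \<Longrightarrow> visits f q \<Longrightarrow> weight p = weight q \<Longrightarrow> p = q"
  using weight_inj by (auto simp: visits_def)

lemma preceded_by_left_unique: "preceded_by f p q \<Longrightarrow> preceded_by f p' q \<Longrightarrow> p = p'"
  unfolding preceded_by_def by (metis nat_neq_iff visits_weight_eq)

lemma preceded_by_right_unique: "preceded_by f p q \<Longrightarrow> preceded_by f p q' \<Longrightarrow> q = q'"
  unfolding preceded_by_def by (metis nat_neq_iff visits_weight_eq)

lemma preceded_by_exists:
  assumes "visits f p" "visits f v" "weight p < weight v"
  shows "\<exists>q. preceded_by f p q"
proof -
  define n where "n = (LEAST n. \<exists>q. visits f q \<and> weight p < weight q \<and> weight q = n)"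
  have "\<exists>q. visits f q \<and> weight p < weight q \<and> weight q = n"
    unfolding n_def by (rule LeastI[of _ "weight v"]) (use assms in blast)
  then obtain q where q: "visits f q" "weight p < weight q" "weight q = n" by blast
  have "\<not> (weight p < weight v \<and> weight v < weight q)" if "visits f v" for v
  proof
    assume wv: "weight p < weight v \<and> weight v < weight q"
    then have "\<not> (\<exists>q. visits f q \<and> weight p < weight q \<and> weight q = weight v)"
      unfolding q(3) n_def by (intro not_less_Least) simp
    then show False using wv that by blast
  qed
  then show ?thesis using q assms by (auto simp: preceded_by_def)
qed

lemma left_limit_preceded_by:
  assumes pq: "preceded_by f p q"
  shows "left_limit f (Inf {t. 0 < t \<and> f t = p}) = q"
proof -
  let ?T = "Inf {t. 0 < t \<and> f t = p}"
  obtain a b where a: "0 < a" "f a = q" and b: "0 < b" "f b = p"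
    using pq by (auto simp: preceded_by_def visits_def)
  have w: "weight p < weight q" using pq by (simp add: preceded_by_def)
  have before: "a < t" if "0 < t" "f t = p" for t
    using weight_antimono[of t a] w that a by (cases "a < t") (auto simp: not_less)
  have "a \<le> ?T" by (rule Inf_greatest) (use before in \<open>auto intro: less_imp_le\<close>)
  moreover have "a \<noteq> ?T"
  proof
    assume eq: "a = ?T"
    have "a < \<infinity>" using before[OF b] by auto
    then obtain u where u: "a < u" "\<And>s. a \<le> s \<Longrightarrow> s < u \<Longrightarrow> f s = q"
      using right_constant[OF a(1)] a(2) by auto
    obtain t where t: "0 < t" "f t = p" "t < u"
      using u(1) unfolding eq by (auto simp: Inf_less_iff)
    then show False using before[of t] u(2)[of t] w by auto
  qed
  ultimately have aT: "a < ?T" by simp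
  show ?thesis
  proof (rule left_limit_eqI[OF aT])
    fix s assume s: "a < s" "s < ?T" "0 < s"
    then have "s \<notin> {t. 0 < t \<and> f t = p}" by (metis Inf_lower not_le)
    then have "f s \<noteq> p" using s by simp
    moreover have "s \<le> b" using b s by (metis (mono_tags) Inf_lower less_imp_le mem_Collect_eq order_trans)
    then have "weight p \<le> weight (f s)" using weight_antimono[of s b] s b by auto
    ultimately have "weight p < weight (f s)"
      using visits_weight_eq[of "f s" p] s pq by (auto simp: preceded_by_def order.order_iff_strict)
    moreover have "weight (f s) \<le> weight q" using weight_antimono[of a s] a s by auto
    ultimately have "weight (f s) = weight q"
      using pq s by (metis visits_at preceded_by_def order.order_iff_strict)
    then show "f s = q" using visits_weight_eq[of "f s" q] pq s by (simp add: preceded_by_def)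
  qed (use a aT in auto)
qed

text \<open>The infimum over an empty set of times is \<open>\<infinity>\<close>, and the path ends in the empty partition.\<close>

lemma left_limit_unvisited:
  assumes "\<not> visits f p"
  shows "left_limit f (Inf {t. 0 < t \<and> f t = p}) = empty_partition"
proof -
  obtain a where a: "0 < a" "a < \<infinity>" "f a = empty_partition" using eventually_empty by blast
  have "{t. 0 < t \<and> f t = p} = {}" using assms by (auto simp: visits_def)
  then have "Inf {t. 0 < t \<and> f t = p} = \<infinity>" by (simp only: Inf_empty top_ereal_def)
  moreover have "left_limit f \<infinity> = empty_partition"
  proof (rule left_limit_eqI[OF a(2)])
    fix s :: ereal assume "a < s" "0 < s"
    then show "f s = empty_partition"
      using weight_antimono[of a s] a by (simp add: weight_eq_0_iff)
  qed simp
  ultimately show ?thesis by simp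
qed

text \<open>If no larger value than \<open>p\<close> is visited, then the path has value \<open>p\<close> on an interval starting
  at time \<open>0\<close>, where the definition of \<^const>\<open>left_limit\<close> yields a fixed default value.\<close>

lemma left_limit_largest:
  assumes p: "visits f p" and max: "\<And>v. visits f v \<Longrightarrow> weight v \<le> weight p"
  shows "left_limit f (Inf {t. 0 < t \<and> f t = p}) = (THE q. True)"
proof -
  obtain b where b: "0 < b" "f b = p" using p by (auto simp: visits_def)
  have "f t = p" if "0 < t" "t \<le> b" for t
    using weight_antimono[of t b] that max[of "f t"] visits_weight_eq[of "f t" p] p b by auto
  then have "Inf {t. 0 < t \<and> f t = p} \<le> e" if "0 < e" for e
    using that b by (intro Inf_lower2[of "min b e"]) auto
  then have "Inf {t. 0 < t \<and> f t = p} \<le> 0" by (meson dense_ge)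
  moreover have "0 \<le> Inf {t. 0 < t \<and> f t = p}" by (rule Inf_greatest) auto
  ultimately have "Inf {t. 0 < t \<and> f t = p} = 0" by (rule antisym)
  then show ?thesis by (simp add: left_limit_def)
qed

lemma backward_chain_eqI:
  assumes "x 0 = empty_partition" "\<And>i. i < j \<Longrightarrow> preceded_by f (x i) (x (Suc i))"
  shows "backward_chain f j = x j"
  using assms(2)
proof (induction j)
  case 0 then show ?case by (simp add: assms(1) at_infty)
next
  case (Suc j)
  then show ?case using left_limit_preceded_by[of "x j" "x (Suc j)"] by simp
qed

lemma jump_time_pos: "0 < \<tau> \<Longrightarrow> \<tau> \<le> jump_time f \<tau> i"
proof (induction i)
  case (Suc i)
  have "jump_time f \<tau> i \<le> jump_time f \<tau> (Suc i)"
    by (simp, rule Inf_greatest) auto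
  then show ?case using Suc by (meson order_trans)
qed simp

text \<open>By right-continuity the jump time is attained, and no value is skipped.\<close>

lemma jump_chain_step:
  assumes \<tau>: "0 < \<tau>" and ne: "jump_chain f \<tau> i \<noteq> empty_partition"
  shows "preceded_by f (jump_chain f \<tau> (Suc i)) (jump_chain f \<tau> i)"
proof -
  define J where "J = jump_time f \<tau> i"
  define a where "a = Inf {t. J < t \<and> f t \<noteq> f J}"
  have J: "0 < J" using jump_time_pos[OF \<tau>, of i] \<tau> by (auto simp: J_def)
  have chain: "jump_chain f \<tau> i = f J" "jump_chain f \<tau> (Suc i) = f a"
    by (simp_all add: jump_chain_def J_def a_def)
  have "J \<noteq> \<infinity>" using ne at_infty unfolding chain by auto
  then have Jfin: "J < \<infinity>" by simp
  have mem: "\<infinity> \<in> {t. J < t \<and> f t \<noteq> f J}" using Jfin ne chain by (simp add: at_infty)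
  have Ja: "J \<le> a" unfolding a_def by (rule Inf_greatest) auto
  have a0: "0 < a" using J Ja by simp
  have less: "f t = f J" if "J \<le> t" "t < a" for t
  proof (cases "t = J")
    case False
    have "t \<notin> {t. J < t \<and> f t \<noteq> f J}" using that(2) unfolding a_def by (metis Inf_lower not_le)
    then show ?thesis using that False by auto
  qed simp
  have fa: "f a \<noteq> f J"
  proof
    assume eq: "f a = f J"
    have "a < \<infinity>" using eq ne chain at_infty by (cases "a = \<infinity>") auto
    then obtain u where u: "a < u" "\<And>s. a \<le> s \<Longrightarrow> s < u \<Longrightarrow> f s = f a"
      using right_constant[OF a0] by auto
    obtain t where t: "J < t" "f t \<noteq> f J" "t < u"
      using u(1) unfolding a_def by (auto simp: Inf_less_iff)
    have "a \<le> t" unfolding a_def by (rule Inf_lower) (use t in auto)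
    then show False using u(2)[of t] t eq by auto
  qed
  have w: "weight (f a) < weight (f J)"
    using weight_antimono[OF J Ja] weight_inj[OF a0 J] fa by (auto simp: order.order_iff_strict)
  have "\<not> (weight (f a) < weight v \<and> weight v < weight (f J))" if "visits f v" for v
  proof
    assume wv: "weight (f a) < weight v \<and> weight v < weight (f J)"
    obtain t where t: "0 < t" "f t = v" using \<open>visits f v\<close> by (auto simp: visits_def)
    have "J < t" using weight_antimono[of t J] t wv by (cases "J < t") (auto simp: not_less)
    moreover have "t < a" using weight_antimono[of a t] a0 t wv by (cases "t < a") (auto simp: not_less)
    ultimately show False using less[of t] t wv by auto
  qed
  then show ?thesis using w J a0 unfolding chain preceded_by_def by auto
qed

lemma num_jumps_reaches_empty:
  assumes \<tau>: "0 < \<tau>"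
  shows "jump_chain f \<tau> (num_jumps f \<tau>) = empty_partition"
    and "i < num_jumps f \<tau> \<Longrightarrow> jump_chain f \<tau> i \<noteq> empty_partition"
proof -
  have "\<exists>i. jump_chain f \<tau> i = empty_partition"
  proof (rule ccontr)
    assume "\<nexists>i. jump_chain f \<tau> i = empty_partition"
    then have "preceded_by f (jump_chain f \<tau> (Suc i)) (jump_chain f \<tau> i)" for i
      using jump_chain_step[OF \<tau>] by blast
    then have dec: "weight (jump_chain f \<tau> (Suc i)) < weight (jump_chain f \<tau> i)" for i
      by (simp add: preceded_by_def)
    have "i + weight (jump_chain f \<tau> i) \<le> weight (f \<tau>)" for i
    proof (induction i)
      case (Suc i) then show ?case using dec[of i] by simp
    qed (simp add: jump_chain_def)
    from this[of "Suc (weight (f \<tau>))"] show False by simp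
  qed
  then show "jump_chain f \<tau> (num_jumps f \<tau>) = empty_partition"
    unfolding num_jumps_def by (rule LeastI_ex)
  show "jump_chain f \<tau> i \<noteq> empty_partition" if "i < num_jumps f \<tau>"
    using that unfolding num_jumps_def by (rule not_less_Least)
qed

lemma reversed_chain_eq_backward_chain:
  assumes \<tau>: "0 < \<tau>" and j: "j \<le> num_jumps f \<tau>"
  shows "reversed_chain f \<tau> j = backward_chain f j"
proof -
  let ?J = "num_jumps f \<tau>"
  have "backward_chain f j = jump_chain f \<tau> (?J - j)"
  proof (rule backward_chain_eqI)
    fix i assume "i < j"
    then have "?J - i = Suc (?J - Suc i)" "?J - Suc i < ?J" using j by auto
    then show "preceded_by f (jump_chain f \<tau> (?J - i)) (jump_chain f \<tau> (?J - Suc i))"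
      using jump_chain_step[OF \<tau>] num_jumps_reaches_empty(2)[OF \<tau>] by simp
  qed (use num_jumps_reaches_empty(1)[OF \<tau>] in simp)
  then show ?thesis using j by (simp add: reversed_chain_def min_def)
qed

text \<open>Rational times suffice to observe which values are visited.\<close>

lemma value_at_rat:
  assumes \<tau>: "0 < \<tau>" and t: "ereal \<tau> \<le> t"
  shows "\<exists>q::rat. \<tau> \<le> of_rat q \<and> f (ereal (of_rat q)) = f t"
proof (cases "t = \<infinity>")
  case True
  obtain a where a: "0 < a" "a < \<infinity>" "f a = empty_partition" using eventually_empty by blast
  obtain a' where a': "a = ereal a'" using a by (cases a) auto
  obtain q :: rat where q: "max \<tau> a' < of_rat q" using of_rat_dense[of "max \<tau> a'" "max \<tau> a' + 1"] by auto
  have "weight (f (ereal (of_rat q))) \<le> weight (f a)"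
    using q a by (intro weight_antimono) (auto simp: a')
  then show ?thesis using q a True by (intro exI[of _ q]) (auto simp: at_infty weight_eq_0_iff)
next
  case False
  obtain t' where t': "t = ereal t'" using t False by (cases t) auto
  have "0 < t" using \<tau> t by (auto simp: t')
  then obtain u where u: "t < u" "\<And>s. t \<le> s \<Longrightarrow> s < u \<Longrightarrow> f s = f t"
    using right_constant[of t] False by auto
  obtain z where z: "t < ereal z" "ereal z < u" using ereal_dense2[OF u(1)] by blast
  obtain q :: rat where q: "t' < of_rat q" "of_rat q < z" using of_rat_dense[of t' z] z by (auto simp: t')
  have "ereal (of_rat q) < u" using q(2) z(2) by (meson less_ereal.simps(1) less_trans)
  then show ?thesis using q t \<tau> by (intro exI[of _ q] conjI u(2)) (auto simp: t')
qed

lemma visits_from_iff_rat: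
  "0 < \<tau> \<Longrightarrow> (\<exists>t\<ge>ereal \<tau>. f t = p) \<longleftrightarrow> (\<exists>q::rat. \<tau> \<le> of_rat q \<and> f (ereal (of_rat q)) = p)"
  using value_at_rat[of \<tau>] by (metis ereal_less_eq(3))

lemma visits_iff_ex_from: "visits f p \<longleftrightarrow> (\<exists>n. \<exists>t\<ge>ereal (1 / real (Suc n)). f t = p)"
proof
  assume "visits f p"
  then obtain t where t: "0 < t" "f t = p" by (auto simp: visits_def)
  have "\<exists>n. ereal (1 / real (Suc n)) \<le> t"
  proof (cases t)
    case (real x)
    then obtain n where "inverse (real (Suc n)) < x" using t reals_Archimedean[of x] by auto
    then show ?thesis using real by (auto simp: inverse_eq_divide intro: less_imp_le)
  qed (use t in auto)
  then show "\<exists>n. \<exists>t\<ge>ereal (1 / real (Suc n)). f t = p" using t by blast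
next
  assume "\<exists>n. \<exists>t\<ge>ereal (1 / real (Suc n)). f t = p"
  then obtain n t where "ereal (1 / real (Suc n)) \<le> t" "f t = p" by blast
  moreover have "0 < ereal (1 / real (Suc n))" by simp
  ultimately have "0 < t" "f t = p" by (blast intro: less_le_trans)+
  then show "visits f p" by auto
qed

end

text \<open>The step function of the backward chain.\<close>

definition predecessor :: "(ereal \<Rightarrow> int_partition) \<Rightarrow> int_partition \<Rightarrow> int_partition" where
  "predecessor f p = left_limit f (Inf {t. 0 < t \<and> f t = p})"

text \<open>A description in terms of visits alone. It includes the case that no larger value than \<open>p\<close> is
  visited: this has probability \<open>0\<close>, but measurability is needed on the whole space.\<close>

lemma (in step_path) predecessor_eq_iff:
  "predecessor f p = q \<longleftrightarrow>
     (visits f p \<and> (\<exists>v. visits f v \<and> weight p < weight v) \<and> preceded_by f p q) \<or>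
     (visits f p \<and> (\<forall>v. visits f v \<longrightarrow> \<not> weight p < weight v) \<and> q = (THE q. True)) \<or>
     (\<not> visits f p \<and> q = empty_partition)"
proof (cases "visits f p")
  case False
  then show ?thesis using left_limit_unvisited[of p] by (auto simp: predecessor_def)
next
  case True
  show ?thesis
  proof (cases "\<exists>v. visits f v \<and> weight p < weight v")
    case ex: True
    then obtain q' where q': "preceded_by f p q'" using preceded_by_exists[OF True] by blast
    then have "predecessor f p = q'" unfolding predecessor_def by (rule left_limit_preceded_by)
    then show ?thesis using True ex q' preceded_by_right_unique[OF q'] by blast
  next
    case False
    then have "predecessor f p = (THE q. True)"
      unfolding predecessor_def by (intro left_limit_largest[OF True]) (auto simp: not_less)
    then show ?thesis using True False by auto
  qed
qed

text \<open>A path through infinitely many values, so that the backward chain never ends.\<close>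

locale unbounded_step_path = step_path +
  assumes unbounded: "\<exists>t>0. n \<le> weight (f t)"
begin

lemma unbounded_at_real: "\<exists>t::real. 0 < t \<and> n \<le> weight (f (ereal t))"
proof -
  obtain t where t: "0 < t" "Suc n \<le> weight (f t)" using unbounded by blast
  then have "t \<noteq> \<infinity>" using at_infty by auto
  then show ?thesis using t by (cases t) (auto intro!: exI)
qed

lemma preceded_by_exists': "visits f p \<Longrightarrow> \<exists>q. preceded_by f p q"
  using preceded_by_exists unbounded[of "Suc (weight p)"] visits_at by (metis Suc_le_lessD)

lemma visits_backward_chain: "visits f (backward_chain f j)"
  and preceded_by_backward_chain: "preceded_by f (backward_chain f j) (backward_chain f (Suc j))"
proof -
  have step: "preceded_by f p (left_limit f (Inf {t. 0 < t \<and> f t = p}))" if "visits f p" for p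
    using preceded_by_exists'[OF that] left_limit_preceded_by by metis
  show *: "visits f (backward_chain f j)"
    by (induction j) (use step in \<open>auto simp: at_infty preceded_by_def\<close>)
  show "preceded_by f (backward_chain f j) (backward_chain f (Suc j))"
    using step[OF *] by simp
qed

lemma backward_chain_eq_iff:
  "(\<forall>i\<le>j. backward_chain f i = x i) \<longleftrightarrow>
     x 0 = empty_partition \<and> (\<forall>i<j. preceded_by f (x i) (x (Suc i)))" (is "?L \<longleftrightarrow> ?R")
proof
  assume ?L
  moreover have "preceded_by f (x i) (x (Suc i))" if "i < j" for i
    using preceded_by_backward_chain[of i] \<open>?L\<close> that by (metis Suc_leI less_imp_le)
  ultimately show ?R by (metis at_infty backward_chain.simps(1) le0)
next
  assume ?R then show ?L using backward_chain_eqI[of x] by auto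
qed

lemma eventually_num_jumps_ge: "\<forall>\<^sub>F \<tau> in at_right 0. m \<le> num_jumps f (ereal \<tau>)"
proof -
  obtain t where t: "0 < t" "Suc (weight (backward_chain f m)) \<le> weight (f (ereal t))"
    using unbounded_at_real by blast
  have mono: "weight (backward_chain f i) \<le> weight (backward_chain f j)" if "i \<le> j" for i j
  proof (rule lift_Suc_mono_le[of "\<lambda>i. weight (backward_chain f i)", OF _ that])
    fix i show "weight (backward_chain f i) \<le> weight (backward_chain f (Suc i))"
      using preceded_by_backward_chain[of i] by (simp add: preceded_by_def)
  qed
  have "m \<le> num_jumps f (ereal \<tau>)" if \<tau>: "0 < \<tau>" "\<tau> < t" for \<tau>
  proof (rule ccontr)
    let ?J = "num_jumps f (ereal \<tau>)"
    assume "\<not> m \<le> ?J"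
    then have "weight (backward_chain f ?J) \<le> weight (backward_chain f m)" by (intro mono) simp
    also have "\<dots> < weight (f (ereal t))" using t by simp
    also have "\<dots> \<le> weight (f (ereal \<tau>))" using \<tau> by (intro weight_antimono) auto
    also have "f (ereal \<tau>) = reversed_chain f (ereal \<tau>) ?J"
      by (simp add: reversed_chain_def jump_chain_def)
    also have "\<dots> = backward_chain f ?J" using \<tau> by (intro reversed_chain_eq_backward_chain) auto
    finally show False by simp
  qed
  then show ?thesis unfolding eventually_at_right_field using t by blast
qed

lemma reversed_chain_limit:
  "limitin (discrete_topology UNIV)
     (\<lambda>\<tau>. map (reversed_chain f (ereal \<tau>)) [0..<Suc m]) (map (backward_chain f) [0..<Suc m]) (at_right 0)"
proof -
  have "\<forall>\<^sub>F \<tau> in at_right 0. 0 < (\<tau>::real)" by (rule eventually_at_right_less)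
  with eventually_num_jumps_ge[of m]
  have "\<forall>\<^sub>F \<tau> in at_right 0.
          map (reversed_chain f (ereal \<tau>)) [0..<Suc m] = map (backward_chain f) [0..<Suc m]"
    by eventually_elim (auto intro!: reversed_chain_eq_backward_chain simp del: upt_Suc)
  then have "\<forall>\<^sub>F \<tau> in at_right 0. map (reversed_chain f (ereal \<tau>)) [0..<Suc m] \<in> U"
    if "map (backward_chain f) [0..<Suc m] \<in> U" for U
    by (rule eventually_mono) (use that in \<open>simp del: upt_Suc map_eq_conv\<close>)
  then show ?thesis by (simp add: limitin_def del: upt_Suc)
qed

end

section \<open>The paths of the partition process\<close>

text \<open>When the clock of \<open>(k, l)\<close> rings, the number of parts of size \<open>k\<close> drops below \<open>l\<close>, unless it
  has done so before.\<close>

definition clock :: "(nat \<Rightarrow> nat \<Rightarrow> 'a \<Rightarrow> real) \<Rightarrow> nat \<times> nat \<Rightarrow> 'a \<Rightarrow> real" where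
  "clock \<epsilon> b \<omega> = \<epsilon> (fst b) (snd b) \<omega> / real (fst b)"

text \<open>The event on which all values of the path are given by their part counts; off this event
  \<^const>\<open>lam\<close> is constantly empty.\<close>

definition well_defined :: "(nat \<Rightarrow> nat \<Rightarrow> 'a \<Rightarrow> real) \<Rightarrow> 'a \<Rightarrow> bool" where
  "well_defined \<epsilon> \<omega> \<longleftrightarrow> (\<forall>s>0. \<exists>p. \<forall>k\<ge>1. enat (part_count k p) = rho \<epsilon> k s \<omega>)"

lemma INF_enat_eq_iff:
  "(INF r\<in>S. enat r) = enat c \<longleftrightarrow> c \<in> S \<and> (\<forall>r<c. r \<notin> S)"
proof (cases "S = {}")
  case True then show ?thesis by (simp add: top_enat_def)
next
  case False
  define m where "m = (LEAST r. r \<in> S)"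
  have m: "m \<in> S" unfolding m_def using False by (metis LeastI ex_in_conv)
  have least: "m \<le> r" if "r \<in> S" for r unfolding m_def using that by (rule Least_le)
  have "(INF r\<in>S. enat r) = enat m"
    by (rule antisym) (use m least in \<open>auto intro: INF_lower INF_greatest\<close>)
  moreover have "m = c \<longleftrightarrow> c \<in> S \<and> (\<forall>r<c. r \<notin> S)"
    using m least[of c] least by (metis le_neq_implies_less not_le)
  ultimately show ?thesis by simp
qed

lemma rho_eq_iff:
  assumes k: "k \<ge> 1"
  shows "rho \<epsilon> k t \<omega> = enat c \<longleftrightarrow>
    ereal (clock \<epsilon> (k, Suc c) \<omega>) \<le> t \<and> (\<forall>l. 1 \<le> l \<and> l \<le> c \<longrightarrow> t < ereal (clock \<epsilon> (k, l) \<omega>))"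
proof -
  have le: "ereal (\<epsilon> k l \<omega>) \<le> ereal (real k) * t \<longleftrightarrow> ereal (clock \<epsilon> (k, l) \<omega>) \<le> t" for l
    using k by (cases t) (auto simp: clock_def field_simps)
  have ball: "(\<forall>r<c. t < ereal (clock \<epsilon> (k, Suc r) \<omega>)) \<longleftrightarrow>
        (\<forall>l. 1 \<le> l \<and> l \<le> c \<longrightarrow> t < ereal (clock \<epsilon> (k, l) \<omega>))"
    by (metis One_nat_def Suc_le_D Suc_le_eq le_add1 plus_1_eq_Suc)
  show ?thesis
    unfolding rho_def INF_enat_eq_iff ball[symmetric] by (simp add: le not_le)
qed

lemma rho_eq_iff_part_count:
  "(\<forall>k\<ge>1. rho \<epsilon> k t \<omega> = enat (part_count k p)) \<longleftrightarrow>
     (\<forall>k\<ge>1. ereal (clock \<epsilon> (k, Suc (part_count k p)) \<omega>) \<le> t) \<and>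
     (\<forall>b\<in>copies p. t < ereal (clock \<epsilon> b \<omega>))"
  by (auto simp: rho_eq_iff)

lemma lam_eq_iff:
  assumes good: "well_defined \<epsilon> \<omega>" and t: "0 < t"
  shows "lam \<epsilon> \<omega> t = p \<longleftrightarrow>
     (\<forall>k\<ge>1. ereal (clock \<epsilon> (k, Suc (part_count k p)) \<omega>) \<le> t) \<and>
     (\<forall>b\<in>copies p. t < ereal (clock \<epsilon> b \<omega>))"
proof -
  obtain q where q: "\<forall>k\<ge>1. enat (part_count k q) = rho \<epsilon> k t \<omega>"
    using good t unfolding well_defined_def by blast
  have "(THE p. \<forall>k\<ge>1. enat (part_count k p) = rho \<epsilon> k t \<omega>) = q"
  proof (rule the_equality[of "\<lambda>p. \<forall>k\<ge>1. enat (part_count k p) = rho \<epsilon> k t \<omega>", OF q])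
    fix p assume "\<forall>k\<ge>1. enat (part_count k p) = rho \<epsilon> k t \<omega>"
    then show "p = q" using q by (intro part_count_inject) (metis enat.inject)
  qed
  then have lam: "lam \<epsilon> \<omega> t = q" using good by (simp add: lam_def well_defined_def)
  have "q = p \<longleftrightarrow> (\<forall>k\<ge>1. rho \<epsilon> k t \<omega> = enat (part_count k p))"
  proof
    assume *: "\<forall>k\<ge>1. rho \<epsilon> k t \<omega> = enat (part_count k p)"
    show "q = p" by (rule part_count_inject) (use * q in \<open>metis enat.inject\<close>)
  qed (use q in auto)
  then show ?thesis unfolding lam rho_eq_iff_part_count .
qed

lemma lam_undefined: "\<not> well_defined \<epsilon> \<omega> \<Longrightarrow> lam \<epsilon> \<omega> t = empty_partition"
  unfolding lam_def well_defined_def by (rule if_not_P)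

lemma lam_props:
  assumes "well_defined \<epsilon> \<omega>" "0 < t"
  shows "k \<ge> 1 \<Longrightarrow> ereal (clock \<epsilon> (k, Suc (part_count k (lam \<epsilon> \<omega> t))) \<omega>) \<le> t"
    and "b \<in> copies (lam \<epsilon> \<omega> t) \<Longrightarrow> t < ereal (clock \<epsilon> b \<omega>)"
  using lam_eq_iff[OF assms, of "lam \<epsilon> \<omega> t"] by auto

lemma copies_lam_antimono:
  assumes good: "well_defined \<epsilon> \<omega>" and s: "0 < s" and st: "s \<le> t"
  shows "copies (lam \<epsilon> \<omega> t) \<subseteq> copies (lam \<epsilon> \<omega> s)"
proof (rule copies_mono, rule ccontr)
  fix k :: nat assume k: "k \<ge> 1"
  assume "\<not> part_count k (lam \<epsilon> \<omega> t) \<le> part_count k (lam \<epsilon> \<omega> s)"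
  then have "(k, Suc (part_count k (lam \<epsilon> \<omega> s))) \<in> copies (lam \<epsilon> \<omega> t)" using k by auto
  then have "t < ereal (clock \<epsilon> (k, Suc (part_count k (lam \<epsilon> \<omega> s))) \<omega>)"
    using s st by (intro lam_props(2)[OF good]) auto
  then show False using lam_props(1)[OF good s k] st by auto
qed

lemma step_path_lam: "step_path (lam \<epsilon> \<omega>)"
proof (cases "well_defined \<epsilon> \<omega>")
  case False
  then have "lam \<epsilon> \<omega> = (\<lambda>_. empty_partition)" by (auto simp: lam_undefined)
  then show ?thesis
    by unfold_locales (auto intro: exI[of _ "1::ereal"] exI[of _ "\<infinity>::ereal"])
next
  case good: True
  show ?thesis
  proof
    show "lam \<epsilon> \<omega> \<infinity> = empty_partition" using lam_eq_iff[OF good] by simp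
  next
    fix s t :: ereal assume "0 < s" "s \<le> t"
    then show "weight (lam \<epsilon> \<omega> t) \<le> weight (lam \<epsilon> \<omega> s)"
      by (intro weight_mono copies_lam_antimono[OF good])
  next
    fix s t :: ereal assume *: "0 < s" "0 < t" "weight (lam \<epsilon> \<omega> s) = weight (lam \<epsilon> \<omega> t)"
    show "lam \<epsilon> \<omega> s = lam \<epsilon> \<omega> t"
    proof (cases "s \<le> t")
      case True
      show ?thesis
        using copies_subset_weight_eq[OF copies_lam_antimono[OF good *(1) True]] *(3) by simp
    next
      case False
      then have "t \<le> s" by simp
      show ?thesis
        using copies_subset_weight_eq[OF copies_lam_antimono[OF good *(2) \<open>t \<le> s\<close>]] *(3) by simp
    qed
  next
    fix t :: ereal assume t: "0 < t" "t < \<infinity>"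
    define p where "p = lam \<epsilon> \<omega> t"
    define u where "u = Min (insert \<infinity> ((\<lambda>b. ereal (clock \<epsilon> b \<omega>)) ` copies p))"
    have "t < u" unfolding u_def using t(2) lam_props(2)[OF good t(1)] by (auto simp: p_def)
    moreover have "lam \<epsilon> \<omega> s = p" if s: "t \<le> s" "s < u" for s
    proof -
      have "0 < s" using t s by simp
      moreover have "ereal (clock \<epsilon> (k, Suc (part_count k p)) \<omega>) \<le> s" if "k \<ge> 1" for k
        using lam_props(1)[OF good t(1) that] s(1) unfolding p_def by (rule order_trans)
      moreover have "s < ereal (clock \<epsilon> b \<omega>)" if "b \<in> copies p" for b
        using s(2) that unfolding u_def by (subst (asm) Min_gr_iff) auto
      ultimately show ?thesis using lam_eq_iff[OF good] by blast
    qed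
    ultimately show "\<exists>u>t. \<forall>s. t \<le> s \<and> s < u \<longrightarrow> lam \<epsilon> \<omega> s = lam \<epsilon> \<omega> t"
      unfolding p_def by blast
  next
    define p where "p = lam \<epsilon> \<omega> 1"
    define K where "K = {k. k \<ge> 1 \<and> part_count k p \<noteq> 0}"
    define t where "t = 1 + (\<Sum>k\<in>K. \<bar>clock \<epsilon> (k, 1) \<omega>\<bar>)"
    have fin: "finite K" unfolding K_def by (rule finite_part_counts)
    have t: "1 \<le> t" by (simp add: t_def sum_nonneg)
    have "clock \<epsilon> (k, 1) \<omega> \<le> t" if k: "k \<ge> 1" for k
    proof (cases "k \<in> K")
      case True
      then have "\<bar>clock \<epsilon> (k, 1) \<omega>\<bar> \<le> (\<Sum>k\<in>K. \<bar>clock \<epsilon> (k, 1) \<omega>\<bar>)"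
        using fin by (intro member_le_sum) auto
      then show ?thesis by (simp add: t_def)
    next
      case False
      then have "part_count k p = 0" using k by (simp add: K_def)
      then have "ereal (clock \<epsilon> (k, 1) \<omega>) \<le> 1"
        using lam_props(1)[OF good _ k, of 1] by (simp add: p_def)
      then show ?thesis using t by (simp add: one_ereal_def)
    qed
    then have "lam \<epsilon> \<omega> (ereal t) = empty_partition"
      using t by (subst lam_eq_iff[OF good]) auto
    then show "\<exists>t. 0 < t \<and> t < \<infinity> \<and> lam \<epsilon> \<omega> t = empty_partition"
      using t by (intro exI[of _ "ereal t"]) auto
  qed
qed

text \<open>Almost sure properties: the path is well defined, the clocks ring at positive times, and
  no two of them ring at the same time.\<close>

definition typical :: "(nat \<Rightarrow> nat \<Rightarrow> 'a \<Rightarrow> real) \<Rightarrow> 'a \<Rightarrow> bool" where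
  "typical \<epsilon> \<omega> \<longleftrightarrow> well_defined \<epsilon> \<omega> \<and> (\<forall>b\<in>{1..} \<times> {1..}. 0 < clock \<epsilon> b \<omega>) \<and>
     inj_on (\<lambda>b. clock \<epsilon> b \<omega>) ({1..} \<times> {1..})"

lemma copies_subset: "copies p \<subseteq> {1..} \<times> {1..}"
  by (auto simp: copies_def)

lemma unbounded_step_path_lam:
  assumes "typical \<epsilon> \<omega>"
  shows "unbounded_step_path (lam \<epsilon> \<omega>)"
proof -
  interpret step_path "lam \<epsilon> \<omega>" by (rule step_path_lam)
  show ?thesis
  proof
    fix n
    have good: "well_defined \<epsilon> \<omega>" and pos: "\<And>b. b \<in> {1..} \<times> {1..} \<Longrightarrow> 0 < clock \<epsilon> b \<omega>"
      using assms by (auto simp: typical_def)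
    define m where "m = Min (insert 1 ((\<lambda>l. clock \<epsilon> (1, l) \<omega>) ` {1..n}))"
    have m: "0 < m" unfolding m_def using pos by (subst Min_gr_iff) auto
    then have t: "0 < ereal (m / 2)" by simp
    have "n \<le> part_count 1 (lam \<epsilon> \<omega> (ereal (m / 2)))"
    proof (rule ccontr)
      let ?c = "Suc (part_count 1 (lam \<epsilon> \<omega> (ereal (m / 2))))"
      assume "\<not> ?thesis"
      then have "?c \<in> {1..n}" by simp
      then have "clock \<epsilon> (1, ?c) \<omega> \<in> (\<lambda>l. clock \<epsilon> (1, l) \<omega>) ` {1..n}" by (rule imageI)
      then have "m \<le> clock \<epsilon> (1, ?c) \<omega>" unfolding m_def by (intro Min_le) simp_all
      moreover have "clock \<epsilon> (1, ?c) \<omega> \<le> m / 2"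
        using lam_props(1)[OF good t, of 1] by simp
      ultimately show False using m by simp
    qed
    then have "{1} \<times> {1..n} \<subseteq> copies (lam \<epsilon> \<omega> (ereal (m / 2)))" by auto
    then have "(\<Sum>b\<in>{1} \<times> {1..n}. fst b) \<le> weight (lam \<epsilon> \<omega> (ereal (m / 2)))"
      unfolding weight_eq_sum_copies by (intro sum_mono2) auto
    moreover have "(\<Sum>b\<in>{1} \<times> {1..n}. fst b) = (\<Sum>b\<in>{1::nat} \<times> {1..n}. 1::nat)"
      by (rule sum.cong) auto
    ultimately have "n \<le> weight (lam \<epsilon> \<omega> (ereal (m / 2)))" by simp
    then show "\<exists>t>0. n \<le> weight (lam \<epsilon> \<omega> t)" using t by blast
  qed
qed

text \<open>The clock of \<open>a\<close> rings before those of all other copies of \<open>p\<close>.\<close>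

definition rings_first :: "(nat \<Rightarrow> nat \<Rightarrow> 'a \<Rightarrow> real) \<Rightarrow> nat \<times> nat \<Rightarrow> int_partition \<Rightarrow> 'a \<Rightarrow> bool" where
  "rings_first \<epsilon> a p \<omega> \<longleftrightarrow> (\<forall>b\<in>copies p - {a}. clock \<epsilon> a \<omega> < clock \<epsilon> b \<omega>)"

lemma preceded_by_if_rings_first:
  assumes good: "well_defined \<epsilon> \<omega>" and vis: "visits (lam \<epsilon> \<omega>) p" and adds: "adds_parts \<kappa> r q p"
    and first: "rings_first \<epsilon> (first_new \<kappa> q) p \<omega>"
  shows "preceded_by (lam \<epsilon> \<omega>) q p"
proof -
  interpret step_path "lam \<epsilon> \<omega>" by (rule step_path_lam)
  define a where "a = first_new \<kappa> q"
  define T where "T = ereal (clock \<epsilon> a \<omega>)"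
  have a: "a \<in> copies p" using first_new_in_copies[OF adds] by (simp add: a_def)
  obtain t where t: "0 < t" "lam \<epsilon> \<omega> t = p" using vis by (auto simp: visits_def)
  note tp = lam_props[OF good t(1), unfolded t(2)]
  have tT: "t < T" using tp(2)[OF a] by (simp add: T_def)
  have sub: "copies q \<subseteq> copies p - {a}"
    using copies_adds_parts[OF adds] by (auto simp: a_def first_new_def)
  have ge: "T \<le> ereal (clock \<epsilon> b \<omega>)" if "b \<in> copies p" for b
    using first that unfolding rings_first_def a_def[symmetric] T_def
    by (cases "b = a") (auto intro: less_imp_le)
  have T: "0 < T" using t tT by simp
  have "ereal (clock \<epsilon> (k, Suc (part_count k q)) \<omega>) \<le> T" if k: "k \<ge> 1" for k
  proof (cases "k = \<kappa>")
    case True then show ?thesis by (simp add: T_def a_def first_new_def)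
  next
    case False
    then have "part_count k q = part_count k p" using adds k by (simp add: adds_parts_def)
    then show ?thesis using tp(1)[OF k] tT by simp
  qed
  moreover have "T < ereal (clock \<epsilon> b \<omega>)" if "b \<in> copies q" for b
    using first that sub by (auto simp: rings_first_def T_def a_def)
  ultimately have Tq: "lam \<epsilon> \<omega> T = q" using lam_eq_iff[OF good T] by blast
  have between: "lam \<epsilon> \<omega> s = p" if s: "t \<le> s" "s < T" for s
  proof -
    have "0 < s" using t(1) s(1) by simp
    moreover have "ereal (clock \<epsilon> (k, Suc (part_count k p)) \<omega>) \<le> s" if "k \<ge> 1" for k
      using tp(1)[OF that] s(1) by (rule order_trans)
    moreover have "s < ereal (clock \<epsilon> b \<omega>)" if "b \<in> copies p" for b
      using s(2) ge[OF that] by (rule less_le_trans)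
    ultimately show ?thesis using lam_eq_iff[OF good] by blast
  qed
  have less: "weight q < weight p"
    using weight_adds_parts[OF adds] adds by (simp add: adds_parts_def)
  have "\<not> (weight q < weight v \<and> weight v < weight p)" if v: "visits (lam \<epsilon> \<omega>) v" for v
  proof
    assume w: "weight q < weight v \<and> weight v < weight p"
    obtain s where s: "0 < s" "lam \<epsilon> \<omega> s = v" using v by (auto simp: visits_def)
    have "s < T" using weight_antimono[of T s] T Tq s w by (cases "s < T") (auto simp: not_less)
    moreover have "t < s" using weight_antimono[of s t] t s w by (cases "t < s") (auto simp: not_less)
    ultimately show False using between[of s] s w by auto
  qed
  then show ?thesis using vis Tq T less by (auto simp: preceded_by_def)
qed

text \<open>Conversely, the copy of \<open>p\<close> that rings first determines the next value of the path. As any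
  two values directly after \<open>p\<close> are equal, \<open>q\<close> is that value.\<close>

lemma rings_first_if_preceded_by:
  assumes typ_omega: "typical \<epsilon> \<omega>" and prec: "preceded_by (lam \<epsilon> \<omega>) q p"
  shows "\<exists>\<kappa> r. adds_parts \<kappa> r q p \<and> rings_first \<epsilon> (first_new \<kappa> q) p \<omega>"
proof -
  interpret step_path "lam \<epsilon> \<omega>" by (rule step_path_lam)
  have good: "well_defined \<epsilon> \<omega>" and inj: "inj_on (\<lambda>b. clock \<epsilon> b \<omega>) ({1..} \<times> {1..})"
    using typ_omega by (auto simp: typical_def)
  have vis: "visits (lam \<epsilon> \<omega>) p" using prec by (simp add: preceded_by_def)
  have "copies p \<noteq> {}" using prec by (auto simp: preceded_by_def weight_eq_sum_copies)
  then obtain a where a: "a \<in> copies p" and min: "\<And>b. b \<in> copies p \<Longrightarrow> clock \<epsilon> a \<omega> \<le> clock \<epsilon> b \<omega>"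
    using arg_min_if_finite[of "copies p" "\<lambda>b. clock \<epsilon> b \<omega>"]
    by (metis finite_copies not_le_imp_less)
  obtain \<kappa> l where al: "a = (\<kappa>, l)" by (cases a)
  have "finite {k. k \<ge> 1 \<and> (if k = \<kappa> then l - 1 else part_count k p) \<noteq> 0}"
    by (rule finite_subset[of _ "insert \<kappa> {k. k \<ge> 1 \<and> part_count k p \<noteq> 0}"])
       (auto intro: finite_part_counts[simplified])
  from part_counts_exist[OF this]
  obtain q' where q': "\<forall>k\<ge>1. part_count k q' = (if k = \<kappa> then l - 1 else part_count k p)" by blast
  have adds: "adds_parts \<kappa> (part_count \<kappa> p - (l - 1)) q' p"
    using a q' by (auto simp: adds_parts_def al)
  have fn: "first_new \<kappa> q' = a" using a q' by (auto simp: first_new_def al)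
  have "clock \<epsilon> a \<omega> < clock \<epsilon> b \<omega>" if "b \<in> copies p - {a}" for b
  proof -
    have "clock \<epsilon> a \<omega> \<noteq> clock \<epsilon> b \<omega>"
      using inj_onD[OF inj, of a b] that a copies_subset[of p] by blast
    then show ?thesis using min[of b] that by auto
  qed
  then have rings: "rings_first \<epsilon> a p \<omega>" by (simp add: rings_first_def)
  have "preceded_by (lam \<epsilon> \<omega>) q' p"
    by (rule preceded_by_if_rings_first[OF good vis adds]) (simp add: fn rings)
  then have "q' = q" using prec by (rule preceded_by_left_unique)
  then show ?thesis using adds rings fn by blast
qed

lemma preceded_by_iff_rings_first:
  assumes typ_omega: "typical \<epsilon> \<omega>" and adds: "adds_parts \<kappa> r q p"
  shows "preceded_by (lam \<epsilon> \<omega>) q p \<longleftrightarrow>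
    visits (lam \<epsilon> \<omega>) p \<and> rings_first \<epsilon> (first_new \<kappa> q) p \<omega>"
proof
  assume prec: "preceded_by (lam \<epsilon> \<omega>) q p"
  obtain \<kappa>' r' where "adds_parts \<kappa>' r' q p" "rings_first \<epsilon> (first_new \<kappa>' q) p \<omega>"
    using rings_first_if_preceded_by[OF typ_omega prec] by blast
  moreover have "\<kappa>' = \<kappa>" using adds_parts_unique(1)[OF adds] calculation(1) .
  ultimately show "visits (lam \<epsilon> \<omega>) p \<and> rings_first \<epsilon> (first_new \<kappa> q) p \<omega>"
    using prec by (simp add: preceded_by_def)
next
  assume "visits (lam \<epsilon> \<omega>) p \<and> rings_first \<epsilon> (first_new \<kappa> q) p \<omega>"
  then show "preceded_by (lam \<epsilon> \<omega>) q p"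
    using preceded_by_if_rings_first[of \<epsilon> \<omega>, OF _ _ adds] typ_omega by (simp add: typical_def)
qed

text \<open>The supremum is taken in the extended reals, which makes its measurability immediate; the value
  is \<open>0\<close> if it is infinite.\<close>

definition family_sup :: "(nat \<Rightarrow> real) \<Rightarrow> real" where
  "family_sup w = real_of_ereal (SUP k\<in>{1..}. ereal (w k))"

text \<open>The first time at which the clocks of \<open>(k, C\<^sub>k(p) + 1)\<close> have rung for all \<open>k\<close>. From then on the
  number of parts of each size is at most as in \<open>p\<close>.\<close>

definition settling_time :: "(nat \<Rightarrow> nat \<Rightarrow> 'a \<Rightarrow> real) \<Rightarrow> int_partition \<Rightarrow> 'a \<Rightarrow> real" where
  "settling_time \<epsilon> p \<omega> = family_sup (\<lambda>k\<in>{1..}. clock \<epsilon> (k, Suc (part_count k p)) \<omega>)"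

lemma settling_time_props:
  assumes typ_omega: "typical \<epsilon> \<omega>"
  shows "(SUP k\<in>{1..}. ereal (clock \<epsilon> (k, Suc (part_count k p)) \<omega>)) = ereal (settling_time \<epsilon> p \<omega>)"
    and "0 < settling_time \<epsilon> p \<omega>"
proof -
  interpret step_path "lam \<epsilon> \<omega>" by (rule step_path_lam)
  have good: "well_defined \<epsilon> \<omega>" and pos: "0 < clock \<epsilon> (1, Suc (part_count 1 p)) \<omega>"
    using typ_omega by (auto simp: typical_def)
  define S where "S = (SUP k\<in>{1..}. ereal (clock \<epsilon> (k, Suc (part_count k p)) \<omega>))"
  obtain t where t: "0 < t" "t < \<infinity>" "lam \<epsilon> \<omega> t = empty_partition" using eventually_empty by blast
  then obtain t' where t': "t = ereal t'" by (cases t) auto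
  define K where "K = {k. k \<ge> 1 \<and> part_count k p \<noteq> 0}"
  define B where "B = t' + (\<Sum>k\<in>K. \<bar>clock \<epsilon> (k, Suc (part_count k p)) \<omega>\<bar>)"
  have fin: "finite K" unfolding K_def by (rule finite_part_counts)
  have "clock \<epsilon> (k, Suc (part_count k p)) \<omega> \<le> B" if k: "k \<ge> 1" for k
  proof (cases "k \<in> K")
    case True
    then have "\<bar>clock \<epsilon> (k, Suc (part_count k p)) \<omega>\<bar> \<le> (\<Sum>k\<in>K. \<bar>clock \<epsilon> (k, Suc (part_count k p)) \<omega>\<bar>)"
      using fin by (intro member_le_sum) auto
    then show ?thesis using t by (simp add: B_def t')
  next
    case False
    then have "part_count k p = 0" using k by (simp add: K_def)
    then have "clock \<epsilon> (k, Suc (part_count k p)) \<omega> \<le> t'"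
      using lam_props(1)[OF good t(1) k] k unfolding t(3) by (simp add: t')
    then show ?thesis by (simp add: B_def sum_nonneg add_increasing2)
  qed
  then have "S \<le> ereal B" unfolding S_def by (intro SUP_least) auto
  moreover have lower: "ereal (clock \<epsilon> (1, Suc (part_count 1 p)) \<omega>) \<le> S"
    unfolding S_def by (rule SUP_upper) simp
  ultimately have fin: "\<bar>S\<bar> \<noteq> \<infinity>" by auto
  have eq: "settling_time \<epsilon> p \<omega> = real_of_ereal S"
    unfolding settling_time_def family_sup_def S_def by simp
  show "S = ereal (settling_time \<epsilon> p \<omega>)" using fin by (simp add: eq ereal_real')
  then show "0 < settling_time \<epsilon> p \<omega>" using lower pos by auto
qed

lemma visits_lam_iff:
  assumes typ_omega: "typical \<epsilon> \<omega>"
  shows "visits (lam \<epsilon> \<omega>) p \<longleftrightarrow> (\<forall>b\<in>copies p. settling_time \<epsilon> p \<omega> < clock \<epsilon> b \<omega>)"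
proof
  have good: "well_defined \<epsilon> \<omega>" using typ_omega by (simp add: typical_def)
  note S = settling_time_props[OF typ_omega, of p]
  {
    assume "visits (lam \<epsilon> \<omega>) p"
    then obtain t where t: "0 < t" "lam \<epsilon> \<omega> t = p" by (auto simp: visits_def)
    note tp = lam_props[OF good t(1), unfolded t(2)]
    have "ereal (settling_time \<epsilon> p \<omega>) \<le> t"
      unfolding S(1)[symmetric] by (rule SUP_least) (use tp(1) in simp)
    then show "\<forall>b\<in>copies p. settling_time \<epsilon> p \<omega> < clock \<epsilon> b \<omega>"
      using tp(2) by (metis le_less_trans less_ereal.simps(1))
  next
    assume *: "\<forall>b\<in>copies p. settling_time \<epsilon> p \<omega> < clock \<epsilon> b \<omega>"
    have "ereal (clock \<epsilon> (k, Suc (part_count k p)) \<omega>) \<le> ereal (settling_time \<epsilon> p \<omega>)"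
      if "k \<ge> 1" for k
      unfolding S(1)[symmetric] by (rule SUP_upper) (use that in simp)
    then have "lam \<epsilon> \<omega> (ereal (settling_time \<epsilon> p \<omega>)) = p"
      using * S(2) by (subst lam_eq_iff[OF good]) auto
    then show "visits (lam \<epsilon> \<omega>) p"
      unfolding visits_def using S(2) by (intro exI[of _ "ereal (settling_time \<epsilon> p \<omega>)"]) simp
  }
qed

section \<open>Independence and exponential clocks\<close>

text \<open>Conditioning on \<open>Y\<close>: here \<open>\<phi> y\<close> is the probability of the event given \<open>Y = y\<close>.\<close>

lemma (in prob_space) prob_indep_var_pair:
  assumes indep: "indep_var S Y T W"
    and R: "Measurable.pred (S \<Otimes>\<^sub>M T) (\<lambda>(y, w). R y w)"
    and [measurable]: "\<phi> \<in> borel_measurable S"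
    and \<phi>: "AE \<omega> in M. prob {\<omega>'\<in>space M. R (Y \<omega>) (W \<omega>')} = \<phi> (Y \<omega>)"
  shows "prob {\<omega>\<in>space M. R (Y \<omega>) (W \<omega>)} = expectation (\<lambda>\<omega>. \<phi> (Y \<omega>))"
proof -
  have [measurable]: "random_variable S Y" "random_variable T W"
    using indep by (auto simp: indep_var_distribution_eq)
  have distr: "distr M (S \<Otimes>\<^sub>M T) (\<lambda>\<omega>. (Y \<omega>, W \<omega>)) = distr M S Y \<Otimes>\<^sub>M distr M T W"
    using indep by (auto simp: indep_var_distribution_eq)
  interpret W: prob_space "distr M T W" by (rule prob_space_distr) measurable
  define A where "A = {x\<in>space (S \<Otimes>\<^sub>M T). (\<lambda>(y, w). R y w) x}"
  have A: "A \<in> sets (S \<Otimes>\<^sub>M T)" unfolding A_def using R by (rule predE)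
  have AE_nonneg: "AE \<omega> in M. 0 \<le> \<phi> (Y \<omega>)"
    using \<phi> by eventually_elim (metis measure_nonneg)
  have "emeasure M {\<omega>\<in>space M. R (Y \<omega>) (W \<omega>)} = emeasure (distr M (S \<Otimes>\<^sub>M T) (\<lambda>\<omega>. (Y \<omega>, W \<omega>))) A"
    using A by (subst emeasure_distr)
      (auto simp: A_def space_pair_measure intro!: arg_cong[of _ _ "emeasure M"] dest: measurable_space[of Y M S, rotated] measurable_space[of W M T, rotated])
  also have "\<dots> = (\<integral>\<^sup>+y. emeasure (distr M T W) (Pair y -` A) \<partial>distr M S Y)"
    unfolding distr by (rule W.emeasure_pair_measure_alt) (use A in simp)
  also have "\<dots> = (\<integral>\<^sup>+\<omega>. emeasure (distr M T W) (Pair (Y \<omega>) -` A) \<partial>M)"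
    using A by (intro nn_integral_distr W.measurable_emeasure_Pair) auto
  also have "\<dots> = (\<integral>\<^sup>+\<omega>. ennreal (prob {\<omega>'\<in>space M. R (Y \<omega>) (W \<omega>')}) \<partial>M)"
  proof (rule nn_integral_cong)
    fix \<omega> assume \<omega>: "\<omega> \<in> space M"
    have "emeasure (distr M T W) (Pair (Y \<omega>) -` A) = emeasure M (W -` (Pair (Y \<omega>) -` A) \<inter> space M)"
      by (rule emeasure_distr) (use A in \<open>auto intro: sets_Pair1\<close>)
    also have "W -` (Pair (Y \<omega>) -` A) \<inter> space M = {\<omega>'\<in>space M. R (Y \<omega>) (W \<omega>')}"
      using \<omega> measurable_space[of Y M S] measurable_space[of W M T]
      by (auto simp: A_def space_pair_measure)
    finally show "emeasure (distr M T W) (Pair (Y \<omega>) -` A) = ennreal (prob {\<omega>'\<in>space M. R (Y \<omega>) (W \<omega>')})"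
      by (simp add: emeasure_eq_measure)
  qed
  also have "\<dots> = (\<integral>\<^sup>+\<omega>. ennreal (\<phi> (Y \<omega>)) \<partial>M)"
    by (rule nn_integral_cong_AE) (use \<phi> in eventually_elim, simp)
  finally have "prob {\<omega>\<in>space M. R (Y \<omega>) (W \<omega>)} = enn2real (\<integral>\<^sup>+\<omega>. ennreal (\<phi> (Y \<omega>)) \<partial>M)"
    by (simp add: measure_def)
  then show ?thesis using AE_nonneg by (subst integral_eq_nn_integral) auto
qed

lemma (in prob_space) expectation_exponential_tail:
  assumes X: "distributed M lborel X (exponential_density l)" and l: "0 < l" and m: "0 \<le> m" and s: "0 \<le> s"
  shows "expectation (\<lambda>\<omega>. indicator {s<..} (X \<omega>) * exp (- m * X \<omega>)) = l / (l + m) * exp (- s * (l + m))"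
proof -
  interpret D: prob_space "density lborel (exponential_density (l + m))"
    using l m by (intro prob_space_exponential_density) simp
  have id: "distributed (density lborel (exponential_density (l + m))) lborel (\<lambda>x. x) (exponential_density (l + m))"
    unfolding distributed_def by (auto simp: distr_id2 exponential_density_nonneg)
  have "expectation (\<lambda>\<omega>. indicator {s<..} (X \<omega>) * exp (- m * X \<omega>)) =
        (\<integral>x. exponential_density l x * (indicator {s<..} x * exp (- m * x)) \<partial>lborel)"
    using l by (intro distributed_integral[OF X, symmetric]) (auto simp: exponential_density_nonneg)
  also have "\<dots> = (\<integral>x. l / (l + m) * (exponential_density (l + m) x * indicator {s<..} x) \<partial>lborel)"
    using l m by (intro Bochner_Integration.integral_cong refl)
      (auto simp: exponential_density_def exp_add[symmetric] field_simps split: split_indicator)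
  also have "\<dots> = l / (l + m) * (\<integral>x. exponential_density (l + m) x * indicator {s<..} x \<partial>lborel)"
    by simp
  also have "(\<integral>x. exponential_density (l + m) x * indicator {s<..} x \<partial>lborel) =
      D.expectation (indicator {s<..})"
    using l m by (intro distributed_integral[OF id]) (auto simp: exponential_density_nonneg)
  also have "\<dots> = D.prob {x \<in> space (density lborel (exponential_density (l + m))). s < x}"
    by (simp add: greaterThan_def)
  also have "\<dots> = exp (- s * (l + m))"
    using l m s by (intro D.exponential_distributedD_gt[OF id]) auto
  finally show ?thesis .
qed

text \<open>The product law of independent variables with rates \<open>1, 2, \<dots>\<close>.\<close>

definition exponential_family :: "(nat \<Rightarrow> real) measure" where
  "exponential_family = (\<Pi>\<^sub>M k\<in>{1..}. density lborel (exponential_density (real k)))"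

lemma measurable_family_sup [measurable]: "family_sup \<in> borel_measurable (\<Pi>\<^sub>M k\<in>{1..}. borel)"
  unfolding family_sup_def by measurable

text \<open>The probabilistic setting, with \<open>X\<close> for the clocks and \<open>I\<close> for their labels.\<close>

locale exponential_clocks = prob_space M for M :: "'a measure" +
  fixes \<epsilon> :: "nat \<Rightarrow> nat \<Rightarrow> 'a \<Rightarrow> real"
  assumes indep_vars_eps: "indep_vars (\<lambda>_. borel) (\<lambda>(k, j). \<epsilon> k j) ({1..} \<times> {1..})"
    and distributed_eps: "\<And>k j. k \<ge> 1 \<Longrightarrow> j \<ge> 1 \<Longrightarrow> distributed M lborel (\<epsilon> k j) (exponential_density 1)"
begin

abbreviation X :: "nat \<times> nat \<Rightarrow> 'a \<Rightarrow> real" where "X \<equiv> clock \<epsilon>"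
abbreviation I :: "(nat \<times> nat) set" where "I \<equiv> {1..} \<times> {1..}"

lemma measurable_clock: "b \<in> I \<Longrightarrow> X b \<in> borel_measurable M"
  using distributed_measurable[OF distributed_eps, of "fst b" "snd b"]
  unfolding clock_def by (auto simp: mem_Times_iff)

lemma measurable_clock' [measurable (raw)]:
  "1 \<le> k \<Longrightarrow> 1 \<le> l \<Longrightarrow> X (k, l) \<in> borel_measurable M"
  by (rule measurable_clock) simp

lemma measurable_clock_copies: "b \<in> copies p \<Longrightarrow> X b \<in> borel_measurable M"
  using copies_subset[of p] by (intro measurable_clock) auto

lemma indep_vars_clock: "indep_vars (\<lambda>_. borel) X I"
proof -
  have "indep_vars (\<lambda>_. borel) (\<lambda>b \<omega>. (case b of (k, j) \<Rightarrow> \<epsilon> k j) \<omega> / real (fst b)) I"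
    by (rule indep_vars_compose2[OF indep_vars_eps]) simp
  then show ?thesis by (simp add: clock_def[abs_def] split_def)
qed

lemma prob_clock_gt:
  assumes "b \<in> I" "0 \<le> s" shows "prob {\<omega>\<in>space M. s < X b \<omega>} = exp (- s * real (fst b))"
proof -
  have "{\<omega>\<in>space M. s < X b \<omega>} = {\<omega>\<in>space M. s * real (fst b) < \<epsilon> (fst b) (snd b) \<omega>}"
    using assms by (auto simp: clock_def field_simps mem_Times_iff)
  then show ?thesis
    using exponential_distributedD_gt[OF distributed_eps, of "fst b" "snd b" "s * real (fst b)"] assms
    by (simp add: mem_Times_iff)
qed

lemma distributed_clock:
  assumes "b \<in> I" shows "distributed M lborel (X b) (exponential_density (real (fst b)))"
proof (subst exponential_distributed_iff, use assms in \<open>simp add: mem_Times_iff\<close>, intro conjI allI impI)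
  show [measurable]: "X b \<in> borel_measurable M" by (rule measurable_clock[OF assms])
  fix a :: real assume a: "0 \<le> a"
  have "prob {\<omega>\<in>space M. X b \<omega> \<le> a} = 1 - prob {\<omega>\<in>space M. a < X b \<omega>}"
    by (subst prob_compl[symmetric]) (auto intro!: arg_cong[of _ _ prob])
  then show "prob {\<omega>\<in>space M. X b \<omega> \<le> a} = 1 - exp (- a * real (fst b))"
    using prob_clock_gt[OF assms a] by simp
qed

lemma indep_var_clock_restrict:
  assumes "A \<inter> B = {}" "A \<subseteq> I" "B \<subseteq> I"
  shows "indep_var (\<Pi>\<^sub>M b\<in>A. borel) (\<lambda>\<omega>. \<lambda>b\<in>A. X b \<omega>) (\<Pi>\<^sub>M b\<in>B. borel) (\<lambda>\<omega>. \<lambda>b\<in>B. X b \<omega>)"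
  by (rule indep_var_restrict[OF indep_vars_clock assms])

lemma prob_clocks_gt:
  assumes K: "finite K" "K \<subseteq> I" and s: "0 \<le> s"
  shows "prob {\<omega>\<in>space M. \<forall>b\<in>K. s < X b \<omega>} = exp (- s * real (\<Sum>b\<in>K. fst b))"
proof (cases "K = {}")
  case True then show ?thesis by (simp add: prob_space)
next
  case False
  have "{\<omega>\<in>space M. \<forall>b\<in>K. s < X b \<omega>} = (\<Inter>b\<in>K. X b -` {s<..} \<inter> space M)" using False by auto
  then have "prob {\<omega>\<in>space M. \<forall>b\<in>K. s < X b \<omega>} = (\<Prod>b\<in>K. prob (X b -` {s<..} \<inter> space M))"
    using indep_varsD[OF indep_vars_clock False K, of "\<lambda>_. {s<..}"] by simp
  also have "\<dots> = (\<Prod>b\<in>K. exp (- s * real (fst b)))"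
  proof (rule prod.cong[OF refl])
    fix b assume "b \<in> K"
    then have "b \<in> I" using K by auto
    have "X b -` {s<..} \<inter> space M = {\<omega>\<in>space M. s < X b \<omega>}" by auto
    then show "prob (X b -` {s<..} \<inter> space M) = exp (- s * real (fst b))"
      using prob_clock_gt[OF \<open>b \<in> I\<close> s] by simp
  qed
  also have "\<dots> = exp (- s * real (\<Sum>b\<in>K. fst b))"
    using K by (simp add: exp_sum[symmetric] sum_distrib_left)
  finally show ?thesis .
qed

section \<open>Almost sure properties of the paths\<close>

lemma AE_clock_pos: "AE \<omega> in M. \<forall>b\<in>I. 0 < X b \<omega>"
proof (subst AE_ball_countable, simp, rule ballI)
  fix b assume b: "b \<in> I"
  have [measurable]: "X b \<in> borel_measurable M" by (rule measurable_clock[OF b])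
  have "prob {\<omega>\<in>space M. 0 < X b \<omega>} = 1" using prob_clock_gt[OF b, of 0] by simp
  then show "AE \<omega> in M. 0 < X b \<omega>" by (subst (asm) prob_Collect_eq_1) auto
qed

lemma AE_clock_inj: "AE \<omega> in M. inj_on (\<lambda>b. X b \<omega>) I"
proof -
  have "AE \<omega> in M. X a \<omega> \<noteq> X b \<omega>" if ab: "a \<in> I" "b \<in> I" "a \<noteq> b" for a b
  proof -
    have [measurable]: "X a \<in> borel_measurable M" "X b \<in> borel_measurable M"
      using ab by (auto intro: measurable_clock)
    have "indep_var borel (X a) borel (X b)"
      using indep_var_compose[OF indep_var_clock_restrict[of "{a}" "{b}"], of "\<lambda>w. w a" borel "\<lambda>w. w b" borel] ab
      by (simp add: comp_def)
    moreover have "prob {\<omega>\<in>space M. y = X b \<omega>} = 0" for y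
    proof -
      have "emeasure M {\<omega>\<in>space M. X b \<omega> \<in> {y}} = (\<integral>\<^sup>+x. ennreal (exponential_density (real (fst b)) x) * indicator {y} x \<partial>lborel)"
        using distributed_emeasure[OF distributed_clock[OF ab(2)], of "{y}"] by (simp add: vimage_def Int_def conj_commute)
      also have "\<dots> = 0"
      proof (subst nn_integral_0_iff_AE)
        show "AE x in lborel. ennreal (exponential_density (real (fst b)) x) * indicator {y} x = 0"
          using AE_lborel_singleton[of y] by eventually_elim simp
      qed simp
      finally show ?thesis by (simp add: measure_def eq_commute[of y])
    qed
    ultimately have "prob {\<omega>\<in>space M. X a \<omega> = X b \<omega>} = expectation (\<lambda>\<omega>. 0)"
      by (intro prob_indep_var_pair) auto
    then show ?thesis by (subst prob_Collect_eq_0[symmetric]) simp_all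
  qed
  then have "AE \<omega> in M. \<forall>a\<in>I. \<forall>b\<in>I. a \<noteq> b \<longrightarrow> X a \<omega> \<noteq> X b \<omega>"
    by (subst AE_ball_countable, simp, intro ballI)+ auto
  then show ?thesis by eventually_elim (auto simp: inj_on_def)
qed

text \<open>Together with the following lemma, this shows that almost surely the values of the path have
  finitely many parts: each size has finite multiplicity, and only finitely many sizes occur.\<close>

lemma AE_finite_count:
  assumes k: "k \<ge> 1" and t: "0 < t"
  shows "AE \<omega> in M. \<exists>l\<ge>1. X (k, l) \<omega> \<le> t"
proof -
  let ?A = "{\<omega>\<in>space M. \<forall>l\<ge>1. t < X (k, l) \<omega>}"
  have "prob ?A \<le> exp (- t * real k) ^ n" for n
  proof -
    have "prob ?A \<le> prob {\<omega>\<in>space M. \<forall>b\<in>{k} \<times> {1..n}. t < X b \<omega>}"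
      using k by (intro finite_measure_mono) (auto simp: measurable_clock intro!: sets.sets_Collect_finite_All')
    also have "\<dots> = exp (- t * real (\<Sum>b\<in>{k} \<times> {1..n}. fst b))"
      using k t by (intro prob_clocks_gt) auto
    also have "(\<Sum>b\<in>{k} \<times> {1..n}. fst b) = (\<Sum>b\<in>{k} \<times> {1..n}. k)" by (rule sum.cong) auto
    finally show ?thesis by (simp add: exp_of_nat_mult[symmetric] mult_ac)
  qed
  moreover have "(\<lambda>n. exp (- t * real k) ^ n) \<longlonglongrightarrow> 0"
    using k t by (intro LIMSEQ_power_zero) simp
  ultimately have "prob ?A \<le> 0" by (intro LIMSEQ_le_const) auto
  then have "prob ?A = 0" by (simp add: measure_le_0_iff)
  then have "AE \<omega> in M. \<not> (\<forall>l\<ge>1. t < X (k, l) \<omega>)"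
    using k by (subst (asm) prob_Collect_eq_0) measurable
  then show ?thesis by eventually_elim (auto simp: not_less)
qed

lemma AE_eventually_no_part:
  assumes t: "0 < t"
  shows "AE \<omega> in M. \<exists>K. \<forall>k\<ge>K. X (Suc k, 1) \<omega> \<le> t"
proof -
  define A where "A k = {\<omega>\<in>space M. t < X (Suc k, 1) \<omega>}" for k
  have prob: "prob (A k) = exp (- t) ^ Suc k" for k
    using prob_clock_gt[of "(Suc k, 1)" t] t exp_of_nat_mult[of "Suc k" "- t"]
    by (simp add: A_def mult.commute)
  have "AE \<omega> in M. \<forall>\<^sub>F k in sequentially. \<omega> \<in> space M - A k"
  proof (rule borel_cantelli_AE1)
    show "summable (\<lambda>k. prob (A k))"
      unfolding prob using t by (subst summable_Suc_iff) (simp add: summable_geometric)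
  qed (auto simp: A_def emeasure_eq_measure)
  then show ?thesis by eventually_elim (auto simp: A_def eventually_sequentially not_less)
qed


lemma rho_antimono: "s \<le> t \<Longrightarrow> rho \<epsilon> k t \<omega> \<le> rho \<epsilon> k s \<omega>"
  unfolding rho_def
  by (rule INF_superset_mono) (auto elim!: order_trans intro: ereal_mult_left_mono)

lemma rho_finite: "k \<ge> 1 \<Longrightarrow> (\<exists>l\<ge>1. ereal (X (k, l) \<omega>) \<le> t) \<Longrightarrow> \<exists>c. rho \<epsilon> k t \<omega> = enat c"
proof -
  assume k: "k \<ge> 1" and ex: "\<exists>l\<ge>1. ereal (X (k, l) \<omega>) \<le> t"
  define c where "c = (LEAST c. ereal (X (k, Suc c) \<omega>) \<le> t)"
  have "\<exists>c. ereal (X (k, Suc c) \<omega>) \<le> t"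
    using ex by (metis One_nat_def Suc_le_D)
  then have "ereal (X (k, Suc c) \<omega>) \<le> t" unfolding c_def by (rule LeastI_ex)
  moreover have "t < ereal (X (k, l) \<omega>)" if l: "1 \<le> l" "l \<le> c" for l
  proof -
    obtain l' where l': "l = Suc l'" using l(1) by (cases l) auto
    have "\<not> ereal (X (k, Suc l') \<omega>) \<le> t"
      by (rule not_less_Least) (use l(2) l' c_def in simp)
    then show ?thesis by (simp add: l')
  qed
  ultimately show ?thesis using rho_eq_iff[OF k, of \<epsilon> t \<omega> c] by blast
qed

text \<open>By monotonicity in time it suffices to consider countably many times.\<close>

lemma well_defined_iff:
  "well_defined \<epsilon> \<omega> \<longleftrightarrow>
     (\<forall>n. (\<forall>k\<ge>1. \<exists>c. rho \<epsilon> k (ereal (1 / real (Suc n))) \<omega> = enat c) \<and>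
          (\<exists>K. \<forall>k\<ge>1. K \<le> k \<longrightarrow> rho \<epsilon> k (ereal (1 / real (Suc n))) \<omega> = enat 0))" (is "_ \<longleftrightarrow> ?R")
proof
  assume good: "well_defined \<epsilon> \<omega>"
  show ?R
  proof
    fix n
    have "0 < ereal (1 / real (Suc n))" by simp
    then obtain p where p: "\<forall>k\<ge>1. enat (part_count k p) = rho \<epsilon> k (ereal (1 / real (Suc n))) \<omega>"
      using good unfolding well_defined_def by blast
    then have "\<forall>k\<ge>1. Suc (parts p 0) \<le> k \<longrightarrow> rho \<epsilon> k (ereal (1 / real (Suc n))) \<omega> = enat 0"
      using part_count_gt_first[of p] by (metis Suc_le_lessD)
    then show "(\<forall>k\<ge>1. \<exists>c. rho \<epsilon> k (ereal (1 / real (Suc n))) \<omega> = enat c) \<and>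
          (\<exists>K. \<forall>k\<ge>1. K \<le> k \<longrightarrow> rho \<epsilon> k (ereal (1 / real (Suc n))) \<omega> = enat 0)"
      using p by metis
  qed
next
  assume R: ?R
  show "well_defined \<epsilon> \<omega>"
    unfolding well_defined_def
  proof (intro allI impI)
    fix s :: ereal assume s: "0 < s"
    have "\<exists>n. ereal (1 / real (Suc n)) \<le> s"
    proof (cases s)
      case (real x)
      then obtain n where "inverse (real (Suc n)) < x" using s reals_Archimedean[of x] by auto
      then show ?thesis using real by (auto simp: inverse_eq_divide intro: less_imp_le)
    qed (use s in auto)
    then obtain n where n: "ereal (1 / real (Suc n)) \<le> s" by blast
    note le = rho_antimono[OF n, of _ \<omega>]
    have fin: "\<forall>k\<ge>1. \<exists>c. rho \<epsilon> k s \<omega> = enat c"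
      using R le by (metis enat_ord_simps(5) enat_ord_code(5) not_enat_eq order_trans top.extremum_uniqueI)
    then obtain c where c: "\<forall>k\<ge>1. rho \<epsilon> k s \<omega> = enat (c k)" by metis
    obtain K where K: "\<forall>k\<ge>1. K \<le> k \<longrightarrow> rho \<epsilon> k (ereal (1 / real (Suc n))) \<omega> = enat 0" using R by blast
    have "c k = 0" if "k \<ge> 1" "K \<le> k" for k
      using le[of k] c K that by (simp add: zero_enat_def)
    then have "{k. k \<ge> 1 \<and> c k \<noteq> 0} \<subseteq> {..<K}" by (metis (mono_tags, lifting) lessThan_iff mem_Collect_eq not_le subsetI)
    then have "finite {k. k \<ge> 1 \<and> c k \<noteq> 0}" by (rule finite_subset) simp
    from part_counts_exist[OF this] c
    show "\<exists>p. \<forall>k\<ge>1. enat (part_count k p) = rho \<epsilon> k s \<omega>" by auto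
  qed
qed

lemma AE_typical: "AE \<omega> in M. typical \<epsilon> \<omega>"
proof -
  have "AE \<omega> in M. well_defined \<epsilon> \<omega>"
    unfolding well_defined_iff AE_all_countable
  proof (intro allI)
    fix n
    have t: "0 < 1 / real (Suc n)" by simp
    have "AE \<omega> in M. \<forall>k\<ge>1. \<exists>l\<ge>1. X (k, l) \<omega> \<le> 1 / real (Suc n)"
      using AE_finite_count[OF _ t] by (auto simp: AE_all_countable)
    moreover have "AE \<omega> in M. \<exists>K. \<forall>k\<ge>K. X (Suc k, 1) \<omega> \<le> 1 / real (Suc n)"
      by (rule AE_eventually_no_part[OF t])
    ultimately show "AE \<omega> in M.
        (\<forall>k\<ge>1. \<exists>c. rho \<epsilon> k (ereal (1 / real (Suc n))) \<omega> = enat c) \<and>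
        (\<exists>K. \<forall>k\<ge>1. K \<le> k \<longrightarrow> rho \<epsilon> k (ereal (1 / real (Suc n))) \<omega> = enat 0)"
    proof eventually_elim
      case (elim \<omega>)
      obtain K where K: "\<forall>k\<ge>K. X (Suc k, 1) \<omega> \<le> 1 / real (Suc n)" using elim(2) by blast
      have "rho \<epsilon> k (ereal (1 / real (Suc n))) \<omega> = enat 0" if "k \<ge> 1" "Suc K \<le> k" for k
      proof -
        have "X (Suc (k - 1), 1) \<omega> \<le> 1 / real (Suc n)" using K that by (intro K[rule_format]) simp
        then show ?thesis using that by (subst rho_eq_iff) auto
      qed
      moreover have "\<exists>c. rho \<epsilon> k (ereal (1 / real (Suc n))) \<omega> = enat c" if "k \<ge> 1" for k
        using elim(1) that by (intro rho_finite) auto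
      ultimately show ?case by blast
    qed
  qed
  with AE_clock_pos AE_clock_inj show ?thesis
    by eventually_elim (simp add: typical_def)
qed

section \<open>Measurability\<close>

lemma measurable_rho [measurable]:
  assumes k: "1 \<le> k" shows "Measurable.pred M (\<lambda>\<omega>. rho \<epsilon> k t \<omega> = enat c)"
  unfolding rho_eq_iff[OF k] using k by measurable

lemma measurable_well_defined [measurable]: "Measurable.pred M (well_defined \<epsilon>)"
  unfolding well_defined_iff[abs_def] by measurable

lemma measurable_lam [measurable]:
  assumes t: "0 < t" shows "Measurable.pred M (\<lambda>\<omega>. lam \<epsilon> \<omega> t = p)"
proof -
  have "lam \<epsilon> \<omega> t = p \<longleftrightarrow>
     (well_defined \<epsilon> \<omega> \<and> (\<forall>k\<ge>1. rho \<epsilon> k t \<omega> = enat (part_count k p))) \<or>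
     (\<not> well_defined \<epsilon> \<omega> \<and> p = empty_partition)" for \<omega>
    using lam_eq_iff[OF _ t, of \<epsilon> \<omega> p] lam_undefined[of \<epsilon> \<omega> t]
    unfolding rho_eq_iff_part_count by auto
  then show ?thesis by (simp only:) measurable
qed

lemma measurable_visits_from [measurable]:
  assumes \<tau>: "0 < \<tau>" shows "Measurable.pred M (\<lambda>\<omega>. \<exists>t\<ge>ereal \<tau>. lam \<epsilon> \<omega> t = p)"
proof -
  have "0 < ereal (of_rat q)" if "\<tau> \<le> of_rat q" for q
    using less_le_trans[OF \<tau> that] by simp
  then show ?thesis
    unfolding step_path.visits_from_iff_rat[OF step_path_lam \<tau>] by measurable
qed

lemma measurable_visits [measurable]: "Measurable.pred M (\<lambda>\<omega>. visits (lam \<epsilon> \<omega>) p)"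
  unfolding step_path.visits_iff_ex_from[OF step_path_lam] by measurable

lemma measurable_preceded_by [measurable]: "Measurable.pred M (\<lambda>\<omega>. preceded_by (lam \<epsilon> \<omega>) p q)"
  unfolding preceded_by_def by measurable

lemma measurable_predecessor [measurable]:
  "(\<lambda>\<omega>. predecessor (lam \<epsilon> \<omega>) p) \<in> M \<rightarrow>\<^sub>M count_space UNIV"
proof (subst measurable_count_space_eq2_countable, simp, safe)
  fix q
  have "Measurable.pred M (\<lambda>\<omega>. predecessor (lam \<epsilon> \<omega>) p = q)"
    unfolding step_path.predecessor_eq_iff[OF step_path_lam] by measurable
  then have "{\<omega>\<in>space M. predecessor (lam \<epsilon> \<omega>) p = q} \<in> sets M" by (rule predE)
  also have "{\<omega>\<in>space M. predecessor (lam \<epsilon> \<omega>) p = q} =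
      (\<lambda>\<omega>. predecessor (lam \<epsilon> \<omega>) p) -` {q} \<inter> space M" by auto
  finally show "(\<lambda>\<omega>. predecessor (lam \<epsilon> \<omega>) p) -` {q} \<inter> space M \<in> sets M" .
qed

lemma measurable_backward_chain [measurable]:
  "(\<lambda>\<omega>. backward_chain (lam \<epsilon> \<omega>) j) \<in> M \<rightarrow>\<^sub>M count_space UNIV"
proof (induction j)
  case 0
  then show ?case by (simp add: step_path.at_infty[OF step_path_lam])
next
  case (Suc j)
  have "(\<lambda>\<omega>. predecessor (lam \<epsilon> \<omega>) (backward_chain (lam \<epsilon> \<omega>) j)) \<in> M \<rightarrow>\<^sub>M count_space UNIV"
    by (rule measurable_compose_countable[OF measurable_predecessor Suc])
  then show ?case by (simp add: predecessor_def)
qed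

section \<open>Probabilities of visits and of chains of jumps\<close>

lemma prob_indep_clock_preds:
  assumes AB: "A \<inter> B = {}" "A \<subseteq> I" "B \<subseteq> I"
    and P: "Measurable.pred (\<Pi>\<^sub>M b\<in>A. borel) P" and Q: "Measurable.pred (\<Pi>\<^sub>M b\<in>B. borel) Q"
  shows "prob {\<omega>\<in>space M. P (\<lambda>b\<in>A. X b \<omega>) \<and> Q (\<lambda>b\<in>B. X b \<omega>)} =
    prob {\<omega>\<in>space M. P (\<lambda>b\<in>A. X b \<omega>)} * prob {\<omega>\<in>space M. Q (\<lambda>b\<in>B. X b \<omega>)}"
proof -
  have "prob ((\<lambda>\<omega>. (\<lambda>b\<in>A. X b \<omega>, \<lambda>b\<in>B. X b \<omega>)) -`
      ({w\<in>space (\<Pi>\<^sub>M b\<in>A. borel). P w} \<times> {w\<in>space (\<Pi>\<^sub>M b\<in>B. borel). Q w}) \<inter> space M) =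
    prob ((\<lambda>\<omega>. \<lambda>b\<in>A. X b \<omega>) -` {w\<in>space (\<Pi>\<^sub>M b\<in>A. borel). P w} \<inter> space M) *
    prob ((\<lambda>\<omega>. \<lambda>b\<in>B. X b \<omega>) -` {w\<in>space (\<Pi>\<^sub>M b\<in>B. borel). Q w} \<inter> space M)"
    by (rule indep_varD[OF indep_var_clock_restrict[OF AB] predE[OF P] predE[OF Q]])
  then show ?thesis
    by (simp add: vimage_def space_PiM Int_def conj_commute)
qed

text \<open>The version of \<open>prob_indep_var_pair\<close> for a real function \<open>Y\<close> of the clocks in \<open>A\<close>.\<close>

lemma prob_clocks_conditioning:
  assumes AB: "A \<inter> B = {}" "A \<subseteq> I" "B \<subseteq> I"
    and [measurable]: "g \<in> borel_measurable (\<Pi>\<^sub>M b\<in>A. borel)"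
    and R: "Measurable.pred (borel \<Otimes>\<^sub>M (\<Pi>\<^sub>M b\<in>B. borel)) (\<lambda>(y, w). R y w)"
    and [measurable]: "\<phi> \<in> borel_measurable borel"
    and Y: "\<And>\<omega>. Y \<omega> = g (\<lambda>b\<in>A. X b \<omega>)"
    and \<phi>: "AE \<omega> in M. prob {\<omega>'\<in>space M. R (Y \<omega>) (\<lambda>b\<in>B. X b \<omega>')} = \<phi> (Y \<omega>)"
  shows "prob {\<omega>\<in>space M. R (Y \<omega>) (\<lambda>b\<in>B. X b \<omega>)} = expectation (\<lambda>\<omega>. \<phi> (Y \<omega>))"
  unfolding Y
proof (rule prob_indep_var_pair[OF indep_var_clock_restrict[OF AB], where R = "\<lambda>v. R (g v)" and \<phi> = "\<lambda>v. \<phi> (g v)"])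
  have "(\<lambda>(v, w). (g v, w)) \<in> (\<Pi>\<^sub>M b\<in>A. borel) \<Otimes>\<^sub>M (\<Pi>\<^sub>M b\<in>B. borel) \<rightarrow>\<^sub>M borel \<Otimes>\<^sub>M (\<Pi>\<^sub>M b\<in>B. borel)"
    by measurable
  from measurable_compose[OF this R]
  show "Measurable.pred ((\<Pi>\<^sub>M b\<in>A. borel) \<Otimes>\<^sub>M (\<Pi>\<^sub>M b\<in>B. borel)) (\<lambda>(v, w). R (g v) w)"
    by (simp add: split_def)
qed (use \<phi> in \<open>simp_all add: Y\<close>)

end

text \<open>A sequence of partitions in which each one arises from the one before by adding equal parts,
  as the values of the path do in reversed time. Only the terms up to \<open>x J\<close> matter.\<close>

locale adding_chain = exponential_clocks +
  fixes x :: "nat \<Rightarrow> int_partition" and \<kappa> r :: "nat \<Rightarrow> nat" and J :: nat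
  assumes adds: "i < J \<Longrightarrow> adds_parts (\<kappa> i) (r i) (x i) (x (Suc i))"
begin

lemma copies_chain: "i \<le> j \<Longrightarrow> j \<le> J \<Longrightarrow> copies (x i) \<subseteq> copies (x j)"
proof (induction j)
  case (Suc j)
  have "copies (x j) \<subseteq> copies (x (Suc j))" using copies_adds_parts[OF adds[of j]] Suc.prems by auto
  then show ?case using Suc by (cases "i = Suc j") auto
qed simp

text \<open>For clock times \<open>w\<close>: in each of \<open>x j, \<dots>, x 1\<close> the copy that rings first is the one that leads
  to the partition with the next smaller index. The condition refers to copies of \<open>x j\<close> only.\<close>

definition races :: "nat \<Rightarrow> (nat \<times> nat \<Rightarrow> real) \<Rightarrow> bool" where
  "races j w \<longleftrightarrow> (\<forall>i<j. \<forall>b\<in>copies (x (Suc i)) - {first_new (\<kappa> i) (x i)}. w (first_new (\<kappa> i) (x i)) < w b)"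

lemma races_eq: "races j (\<lambda>b. X b \<omega>) \<longleftrightarrow> (\<forall>i<j. rings_first \<epsilon> (first_new (\<kappa> i) (x i)) (x (Suc i)) \<omega>)"
  by (simp add: races_def rings_first_def)

lemma races_restrict:
  assumes "j \<le> J" "copies (x j) \<subseteq> K"
  shows "races j (restrict w K) \<longleftrightarrow> races j w"
proof -
  have "copies (x (Suc i)) \<subseteq> K" "first_new (\<kappa> i) (x i) \<in> K" if "i < j" for i
    using copies_chain[of "Suc i" j] first_new_in_copies[OF adds[of i]] that assms by auto
  then show ?thesis unfolding races_def by (intro all_cong ball_cong refl) (auto simp: subset_iff)
qed

lemma measurable_races:
  assumes "j \<le> J" "copies (x j) \<subseteq> K"
  shows "Measurable.pred (\<Pi>\<^sub>M b\<in>K. borel) (races j)"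
proof -
  have K: "copies (x (Suc i)) \<subseteq> K" "first_new (\<kappa> i) (x i) \<in> K" if "i < j" for i
    using copies_chain[of "Suc i" j] first_new_in_copies[OF adds[of i]] that assms by auto
  have less: "Measurable.pred (\<Pi>\<^sub>M b\<in>K. borel) (\<lambda>w. w a < (w b :: real))" if "a \<in> K" "b \<in> K" for a b
    using that by measurable
  have "Measurable.pred (\<Pi>\<^sub>M b\<in>K. borel)
     (\<lambda>w. \<forall>i\<in>{..<j}. \<forall>b\<in>copies (x (Suc i)) - {first_new (\<kappa> i) (x i)}. w (first_new (\<kappa> i) (x i)) < (w b :: real))"
  proof (intro pred_intros_countable_bounded(3))
    fix i b assume "i \<in> {..<j}" "b \<in> copies (x (Suc i)) - {first_new (\<kappa> i) (x i)}"
    then have "first_new (\<kappa> i) (x i) \<in> K" "b \<in> K" using K[of i] by auto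
    then show "Measurable.pred (\<Pi>\<^sub>M b\<in>K. borel) (\<lambda>w. w (first_new (\<kappa> i) (x i)) < (w b :: real))"
      by (rule less)
  qed
  then show ?thesis unfolding races_def[abs_def] by (simp only: lessThan_iff Ball_def)
qed

text \<open>In the induction step one conditions on the clock \<open>X a\<close> of rate \<open>\<kappa> j\<close> that rings first among the
  copies of \<open>x (j + 1)\<close>. If it rings at time \<open>y\<close>, then the clocks of the other copies ring after \<open>y\<close>, and
  those among them that are copies of \<open>x j\<close> fall under the induction hypothesis with \<open>s = y\<close>.\<close>

lemma prob_clocks_gt_races:
  assumes "j \<le> J" "0 \<le> s"
  shows "prob {\<omega>\<in>space M. (\<forall>b\<in>copies (x j). s < X b \<omega>) \<and> races j (\<lambda>b. X b \<omega>)} =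
    (\<Prod>i<j. real (\<kappa> i) / real (weight (x (Suc i)))) * exp (- s * real (weight (x j)))"
  using assms
proof (induction j arbitrary: s)
  case 0
  then show ?case
    using prob_clocks_gt[OF finite_copies copies_subset, of s "x 0"]
    by (simp add: races_def weight_eq_sum_copies)
next
  case (Suc j)
  define p q k a Q where "p = x (Suc j)" and "q = x j" and "k = \<kappa> j" and "a = first_new k q"
    and "Q = (\<Prod>i<j. real (\<kappa> i) / real (weight (x (Suc i))))"
  \<comment> \<open>\<open>E\<close> consists of the copies that disappear together with \<open>a\<close>, \<open>L\<close> of all copies of \<open>p\<close> but \<open>a\<close>;
    \<open>m\<close> is the total rate of \<open>L\<close>.\<close>
  define E where "E = {k} \<times> {Suc (Suc (part_count k q))..part_count k q + r j}"
  define L where "L = E \<union> copies q"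
  define m where "m = weight p - k"
  have jJ: "j \<le> J" using Suc.prems by simp
  have add: "adds_parts k (r j) q p" using adds[of j] Suc.prems by (simp add: k_def q_def p_def)
  have k: "1 \<le> k" "1 \<le> r j" using add by (auto simp: adds_parts_def)
  have aI: "a \<in> I" using k by (simp add: a_def first_new_def)
  have cp: "copies p = insert a L"
    using k by (auto simp: copies_adds_parts[OF add] L_def E_def a_def first_new_def)
  have aL: "a \<notin> L" by (auto simp: L_def E_def a_def first_new_def)
  have Eq: "E \<inter> copies q = {}" by (auto simp: E_def)
  have LI: "L \<subseteq> I" using k copies_subset[of q] by (auto simp: L_def E_def)
  have finE: "finite E" by (simp add: E_def)
  have wp: "weight p = k + ((\<Sum>b\<in>E. fst b) + weight q)"
    unfolding weight_eq_sum_copies[of p] cp using aL finE Eq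
    by (simp add: L_def sum.union_disjoint weight_eq_sum_copies) (simp add: a_def first_new_def)
  then have m: "weight p = k + m" "m = (\<Sum>b\<in>E. fst b) + weight q" by (auto simp: m_def)
  define R where "R y w \<longleftrightarrow> s < y \<and> (\<forall>b\<in>L. y < w b) \<and> races j w" for y :: real and w
  have rL: "races j (\<lambda>b\<in>L. X b \<omega>) \<longleftrightarrow> races j (\<lambda>b. X b \<omega>)"
    and rq: "races j (\<lambda>b\<in>copies q. X b \<omega>) \<longleftrightarrow> races j (\<lambda>b. X b \<omega>)" for \<omega>
    by (intro races_restrict jJ; simp add: L_def q_def)+
  have ball_L: "(\<forall>b\<in>L. P b) \<longleftrightarrow> (\<forall>b\<in>E. P b) \<and> (\<forall>b\<in>copies q. P b)" for P
    by (auto simp: L_def)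
  have prob_R: "prob {\<omega>\<in>space M. R y (\<lambda>b\<in>L. X b \<omega>)} = indicator {s<..} y * (Q * exp (- real m * y))"
    if y: "0 \<le> y" for y
  proof (cases "s < y")
    case True
    have [measurable]: "Measurable.pred (\<Pi>\<^sub>M b\<in>copies q. borel) (races j)"
      by (rule measurable_races[OF jJ]) (simp add: q_def)
    have "{\<omega>\<in>space M. R y (\<lambda>b\<in>L. X b \<omega>)} =
        {\<omega>\<in>space M. (\<forall>b\<in>E. y < (\<lambda>b\<in>E. X b \<omega>) b) \<and>
          ((\<forall>b\<in>copies q. y < (\<lambda>b\<in>copies q. X b \<omega>) b) \<and> races j (\<lambda>b\<in>copies q. X b \<omega>))}"
      using True by (auto simp: R_def rL rq ball_L)
    also have "prob \<dots> = prob {\<omega>\<in>space M. \<forall>b\<in>E. y < (\<lambda>b\<in>E. X b \<omega>) b} *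
       prob {\<omega>\<in>space M. (\<forall>b\<in>copies q. y < (\<lambda>b\<in>copies q. X b \<omega>) b) \<and> races j (\<lambda>b\<in>copies q. X b \<omega>)}"
      using Eq LI finE by (intro prob_indep_clock_preds) (auto simp: L_def, measurable)
    also have "\<dots> = exp (- y * real (\<Sum>b\<in>E. fst b)) * (Q * exp (- y * real (weight q)))"
      using prob_clocks_gt[of E y] finE LI y Suc.IH[OF jJ y]
      by (simp add: rq Q_def q_def[symmetric] L_def)
    finally show ?thesis using True by (simp add: m exp_add[symmetric] algebra_simps)
  qed (simp add: R_def)
  have "prob {\<omega>\<in>space M. (\<forall>b\<in>copies (x (Suc j)). s < X b \<omega>) \<and> races (Suc j) (\<lambda>b. X b \<omega>)} =
        prob {\<omega>\<in>space M. R (X a \<omega>) (\<lambda>b\<in>L. X b \<omega>)}"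
  proof -
    have "races (Suc j) (\<lambda>b. X b \<omega>) \<longleftrightarrow> races j (\<lambda>b. X b \<omega>) \<and> (\<forall>b\<in>L. X a \<omega> < X b \<omega>)" for \<omega>
      using aL unfolding races_def less_Suc_eq p_def[symmetric] q_def[symmetric] k_def[symmetric] a_def[symmetric]
      by (auto simp: cp[unfolded p_def] p_def q_def k_def a_def)
    then show ?thesis
      unfolding p_def[symmetric] cp R_def rL
      by (intro arg_cong[of _ _ prob] Collect_cong) (auto intro: less_trans)
  qed
  also have "\<dots> = expectation (\<lambda>\<omega>. indicator {s<..} (X a \<omega>) * (Q * exp (- real m * X a \<omega>)))"
  proof (rule prob_clocks_conditioning[where A = "{a}" and B = L and g = "\<lambda>v. v a"])
    show "{a} \<inter> L = {}" "{a} \<subseteq> I" "L \<subseteq> I" using aL aI LI by auto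
    have [measurable]: "Measurable.pred (\<Pi>\<^sub>M b\<in>L. borel) (races j)"
      by (rule measurable_races[OF jJ]) (simp add: L_def q_def)
    show "Measurable.pred (borel \<Otimes>\<^sub>M (\<Pi>\<^sub>M b\<in>L. borel)) (\<lambda>(y, w). R y w)"
      unfolding R_def by measurable
    show "AE \<omega> in M. prob {\<omega>'\<in>space M. R (X a \<omega>) (\<lambda>b\<in>L. X b \<omega>')} =
        indicator {s<..} (X a \<omega>) * (Q * exp (- real m * X a \<omega>))"
      using AE_clock_pos
    proof eventually_elim
      case (elim \<omega>)
      then have "0 \<le> X a \<omega>" using aI by (auto intro: less_imp_le)
      then show ?case by (rule prob_R)
    qed
  qed simp_all
  also have "\<dots> = Q * expectation (\<lambda>\<omega>. indicator {s<..} (X a \<omega>) * exp (- real m * X a \<omega>))"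
    by (subst integral_mult_right_zero[symmetric]) (simp add: mult_ac)
  also have "\<dots> = Q * (real k / real (weight p) * exp (- s * real (weight p)))"
    using expectation_exponential_tail[OF distributed_clock[OF aI], of "real m" s] k Suc.prems
    by (simp add: a_def first_new_def m(1))
  finally show ?case by (simp add: Q_def p_def k_def)
qed


end

context exponential_clocks
begin

lemma settling_time_eq_restrict:
  "settling_time \<epsilon> p \<omega> = family_sup (\<lambda>k\<in>{1..}. (\<lambda>b\<in>{(k, Suc (part_count k p)) |k. k \<ge> 1}. X b \<omega>) (k, Suc (part_count k p)))"
  unfolding settling_time_def by (intro arg_cong[of _ _ family_sup]) auto

text \<open>For each size, the first clock that is not among the copies of \<open>p\<close>: their joint law does not
  depend on \<open>p\<close>.\<close>

lemma distr_next_clocks: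
  "distr M (\<Pi>\<^sub>M k\<in>{1..}. borel) (\<lambda>\<omega>. \<lambda>k\<in>{1..}. X (k, Suc (part_count k p)) \<omega>) = exponential_family"
proof -
  have "indep_vars (\<lambda>k. \<Pi>\<^sub>M b\<in>{(k, Suc (part_count k p))}. borel)
      (\<lambda>k \<omega>. \<lambda>b\<in>{(k, Suc (part_count k p))}. X b \<omega>) {1..}"
    by (rule indep_vars_restrict[OF indep_vars_clock]) (auto simp: disjoint_family_on_def)
  from indep_vars_compose2[OF this, of "\<lambda>k w. w (k, Suc (part_count k p))" "\<lambda>_. borel"]
  have indep: "indep_vars (\<lambda>_. borel) (\<lambda>k. X (k, Suc (part_count k p))) {1::nat..}"
    by simp
  have "distr M (\<Pi>\<^sub>M k\<in>{1..}. borel) (\<lambda>\<omega>. \<lambda>k\<in>{1..}. X (k, Suc (part_count k p)) \<omega>) =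
      (\<Pi>\<^sub>M k\<in>{1..}. distr M borel (X (k, Suc (part_count k p))))"
    using indep by (subst (asm) indep_vars_iff_distr_eq_PiM') auto
  also have "\<dots> = exponential_family"
    unfolding exponential_family_def
  proof (rule PiM_cong[OF refl])
    fix k :: nat assume "k \<in> {1..}"
    then have "distributed M lborel (X (k, Suc (part_count k p))) (exponential_density (real k))"
      using distributed_clock[of "(k, Suc (part_count k p))"] by simp
    from distributed_distr_eq_density[OF this]
    show "distr M borel (X (k, Suc (part_count k p))) = density lborel (exponential_density (real k))"
      by (simp add: distr_cong[OF refl sets_lborel[symmetric] refl])
  qed
  finally show ?thesis .
qed

text \<open>The expectation of \<open>exp (- n * S)\<close> for the supremum \<open>S\<close> of the exponential family. It turns out
  to be the probability of visiting any given partition of \<open>n\<close>.\<close>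

definition visit_integral :: "nat \<Rightarrow> real" where
  "visit_integral n = (\<integral>w. exp (- family_sup w * real n) \<partial>exponential_family)"

lemma expectation_settling_time:
  "expectation (\<lambda>\<omega>. exp (- settling_time \<epsilon> p \<omega> * real n)) = visit_integral n"
proof -
  have [measurable]: "(\<lambda>\<omega>. \<lambda>k\<in>{1..}. X (k, Suc (part_count k p)) \<omega>) \<in> M \<rightarrow>\<^sub>M (\<Pi>\<^sub>M k\<in>{1..}. borel)"
    by (rule measurable_restrict) simp
  have [measurable]: "(\<lambda>w. exp (- family_sup w * real n)) \<in> borel_measurable (\<Pi>\<^sub>M k\<in>{1..}. borel)"
    by measurable
  show ?thesis
    unfolding visit_integral_def distr_next_clocks[of p, symmetric] settling_time_def
    by (rule integral_distr[symmetric]) measurable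
qed

lemma measurable_settling_time [measurable]: "settling_time \<epsilon> p \<in> borel_measurable M"
proof -
  have "(\<lambda>\<omega>. \<lambda>k\<in>{1..}. X (k, Suc (part_count k p)) \<omega>) \<in> M \<rightarrow>\<^sub>M (\<Pi>\<^sub>M k\<in>{1..}. borel)"
    by (rule measurable_restrict) simp
  from measurable_compose[OF this measurable_family_sup]
  show ?thesis by (simp add: settling_time_def[abs_def])
qed

lemma visit_integral_pos: "0 < visit_integral n"
proof -
  let ?Z = "\<lambda>\<omega>. exp (- settling_time \<epsilon> empty_partition \<omega> * real n)"
  have AE: "AE \<omega> in M. 0 < settling_time \<epsilon> empty_partition \<omega>"
    using AE_typical by eventually_elim (rule settling_time_props(2))
  have int: "integrable M ?Z"
    by (rule integrable_const_bound[of _ 1]) (use AE in \<open>eventually_elim, simp\<close>, simp)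
  have "expectation ?Z \<noteq> 0"
  proof
    assume "expectation ?Z = 0"
    then have "AE \<omega> in M. ?Z \<omega> = 0" using int by (subst (asm) integral_nonneg_eq_0_iff_AE) auto
    then show False by simp
  qed
  moreover have "0 \<le> expectation ?Z" by simp
  ultimately show ?thesis unfolding expectation_settling_time by linarith
qed

end

context adding_chain
begin

text \<open>Conditioning on the settling time of \<open>x j\<close>, which is independent of the clocks of its copies.\<close>

lemma prob_visits_races:
  assumes j: "j \<le> J"
  shows "prob {\<omega>\<in>space M. visits (lam \<epsilon> \<omega>) (x j) \<and> (\<forall>i<j. preceded_by (lam \<epsilon> \<omega>) (x i) (x (Suc i)))} =
    (\<Prod>i<j. real (\<kappa> i) / real (weight (x (Suc i)))) * visit_integral (weight (x j))"
proof -
  define p where "p = x j"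
  define Q where "Q = (\<Prod>i<j. real (\<kappa> i) / real (weight (x (Suc i))))"
  define A where "A = {(k, Suc (part_count k p)) |k. k \<ge> 1}"
  define R where "R y w \<longleftrightarrow> (\<forall>b\<in>copies p. y < w b) \<and> races j w" for y :: real and w
  have races: "races j (\<lambda>b\<in>copies p. X b \<omega>) \<longleftrightarrow> races j (\<lambda>b. X b \<omega>)" for \<omega>
    by (rule races_restrict[OF j]) (simp add: p_def)
  have [measurable]: "Measurable.pred (\<Pi>\<^sub>M b\<in>copies p. borel) (races j)"
    by (rule measurable_races[OF j]) (simp add: p_def)
  have R_meas [measurable]: "Measurable.pred (borel \<Otimes>\<^sub>M (\<Pi>\<^sub>M b\<in>copies p. borel)) (\<lambda>(y, w). R y w)"
    unfolding R_def by measurable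
  \<comment> \<open>From \<open>x j\<close> the races lead from each partition to the one before it, so that all are visited.\<close>
  have down: "visits (lam \<epsilon> \<omega>) (x j) \<and> (\<forall>i<j. preceded_by (lam \<epsilon> \<omega>) (x i) (x (Suc i))) \<longleftrightarrow>
      visits (lam \<epsilon> \<omega>) (x j) \<and> (\<forall>i<j. rings_first \<epsilon> (first_new (\<kappa> i) (x i)) (x (Suc i)) \<omega>)"
    if typ_omega: "typical \<epsilon> \<omega>" for \<omega>
    using j
  proof (induction j)
    case (Suc j)
    have *: "preceded_by (lam \<epsilon> \<omega>) (x j) (x (Suc j)) \<longleftrightarrow>
      visits (lam \<epsilon> \<omega>) (x (Suc j)) \<and> rings_first \<epsilon> (first_new (\<kappa> j) (x j)) (x (Suc j)) \<omega>"
      using Suc.prems by (intro preceded_by_iff_rings_first[OF typ_omega adds]) simp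
    have "visits (lam \<epsilon> \<omega>) (x (Suc j)) \<and> (\<forall>i<Suc j. preceded_by (lam \<epsilon> \<omega>) (x i) (x (Suc i))) \<longleftrightarrow>
      preceded_by (lam \<epsilon> \<omega>) (x j) (x (Suc j)) \<and>
      (visits (lam \<epsilon> \<omega>) (x j) \<and> (\<forall>i<j. preceded_by (lam \<epsilon> \<omega>) (x i) (x (Suc i))))"
      unfolding less_Suc_eq preceded_by_def by blast
    also have "visits (lam \<epsilon> \<omega>) (x j) \<and> (\<forall>i<j. preceded_by (lam \<epsilon> \<omega>) (x i) (x (Suc i))) \<longleftrightarrow>
      visits (lam \<epsilon> \<omega>) (x j) \<and> (\<forall>i<j. rings_first \<epsilon> (first_new (\<kappa> i) (x i)) (x (Suc i)) \<omega>)"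
      using Suc by simp
    finally have 1: "visits (lam \<epsilon> \<omega>) (x (Suc j)) \<and> (\<forall>i<Suc j. preceded_by (lam \<epsilon> \<omega>) (x i) (x (Suc i))) \<longleftrightarrow>
      preceded_by (lam \<epsilon> \<omega>) (x j) (x (Suc j)) \<and>
      visits (lam \<epsilon> \<omega>) (x j) \<and> (\<forall>i<j. rings_first \<epsilon> (first_new (\<kappa> i) (x i)) (x (Suc i)) \<omega>)" .
    have 2: "preceded_by (lam \<epsilon> \<omega>) (x j) (x (Suc j)) \<Longrightarrow> visits (lam \<epsilon> \<omega>) (x j)"
      by (simp add: preceded_by_def)
    show ?case unfolding 1 using 2 * by (metis less_Suc_eq)
  qed simp
  have "prob {\<omega>\<in>space M. visits (lam \<epsilon> \<omega>) (x j) \<and> (\<forall>i<j. preceded_by (lam \<epsilon> \<omega>) (x i) (x (Suc i)))} =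
      prob {\<omega>\<in>space M. R (settling_time \<epsilon> p \<omega>) (\<lambda>b\<in>copies p. X b \<omega>)}"
  proof (rule measure_eq_AE)
    have "(\<lambda>\<omega>. \<lambda>b\<in>copies p. X b \<omega>) \<in> M \<rightarrow>\<^sub>M (\<Pi>\<^sub>M b\<in>copies p. borel)"
      by (rule measurable_restrict) (rule measurable_clock_copies)
    then have "(\<lambda>\<omega>. (settling_time \<epsilon> p \<omega>, \<lambda>b\<in>copies p. X b \<omega>)) \<in> M \<rightarrow>\<^sub>M borel \<Otimes>\<^sub>M (\<Pi>\<^sub>M b\<in>copies p. borel)"
      by measurable
    from predE[OF measurable_compose[OF this R_meas]]
    show "{\<omega>\<in>space M. R (settling_time \<epsilon> p \<omega>) (\<lambda>b\<in>copies p. X b \<omega>)} \<in> sets M" by simp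
    show "AE \<omega> in M. \<omega> \<in> {\<omega>\<in>space M. visits (lam \<epsilon> \<omega>) (x j) \<and> (\<forall>i<j. preceded_by (lam \<epsilon> \<omega>) (x i) (x (Suc i)))}
       \<longleftrightarrow> \<omega> \<in> {\<omega>\<in>space M. R (settling_time \<epsilon> p \<omega>) (\<lambda>b\<in>copies p. X b \<omega>)}"
      using AE_typical
    proof eventually_elim
      case (elim \<omega>)
      show ?case
        unfolding mem_Collect_eq R_def races races_eq down[OF elim]
        unfolding visits_lam_iff[OF elim] p_def by simp
    qed
  qed simp
  also have "\<dots> = expectation (\<lambda>\<omega>. Q * exp (- settling_time \<epsilon> p \<omega> * real (weight p)))"
  proof (rule prob_clocks_conditioning[where A = A and B = "copies p"
        and g = "\<lambda>v. family_sup (\<lambda>k\<in>{1..}. v (k, Suc (part_count k p)))"])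
    show "A \<inter> copies p = {}" "A \<subseteq> I" "copies p \<subseteq> I" by (auto simp: A_def copies_def)
    have "(\<lambda>v. \<lambda>k\<in>{1..}. v (k, Suc (part_count k p))) \<in> (\<Pi>\<^sub>M b\<in>A. borel) \<rightarrow>\<^sub>M (\<Pi>\<^sub>M k\<in>{1..}. borel :: real measure)"
      by (rule measurable_restrict, rule measurable_component_singleton) (auto simp: A_def)
    from measurable_compose[OF this measurable_family_sup]
    show "(\<lambda>v. family_sup (\<lambda>k\<in>{1..}. v (k, Suc (part_count k p)))) \<in> borel_measurable (\<Pi>\<^sub>M b\<in>A. borel)" .
    show "settling_time \<epsilon> p \<omega> = family_sup (\<lambda>k\<in>{1..}. (\<lambda>b\<in>A. X b \<omega>) (k, Suc (part_count k p)))" for \<omega>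
      unfolding A_def by (rule settling_time_eq_restrict)
    have prob_R: "prob {\<omega>\<in>space M. R y (\<lambda>b\<in>copies p. X b \<omega>)} = Q * exp (- y * real (weight p))" if "0 \<le> y" for y
      using prob_clocks_gt_races[OF j that, folded p_def Q_def] by (simp add: R_def races)
    show "AE \<omega> in M. prob {\<omega>'\<in>space M. R (settling_time \<epsilon> p \<omega>) (\<lambda>b\<in>copies p. X b \<omega>')} =
        Q * exp (- settling_time \<epsilon> p \<omega> * real (weight p))"
      using AE_typical
    proof eventually_elim
      case (elim \<omega>)
      show ?case by (intro prob_R less_imp_le settling_time_props(2) elim)
    qed
  qed (rule R_meas, simp)
  also have "\<dots> = Q * visit_integral (weight p)"
    by (simp add: expectation_settling_time[simplified])
  finally show ?thesis by (simp add: Q_def p_def)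
qed

end

context exponential_clocks
begin

lemma prob_visits: "prob {\<omega>\<in>space M. visits (lam \<epsilon> \<omega>) p} = visit_integral (weight p)"
proof -
  interpret adding_chain M \<epsilon> "\<lambda>_. p" "\<lambda>_. 0" "\<lambda>_. 0" 0 by unfold_locales simp
  show ?thesis using prob_visits_races[of 0] by simp
qed

lemma visit_prob_tendsto:
  "((\<lambda>\<tau>::real. prob {\<omega>\<in>space M. \<exists>t\<ge>ereal \<tau>. lam \<epsilon> \<omega> t = p}) \<longlongrightarrow> visit_integral (weight p)) (at_right 0)"
proof -
  define A where "A \<tau> = {\<omega>\<in>space M. \<exists>t\<ge>ereal \<tau>. lam \<epsilon> \<omega> t = p}" for \<tau> :: real
  define V where "V = {\<omega>\<in>space M. visits (lam \<epsilon> \<omega>) p}"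
  have A: "A \<tau> \<in> sets M" if "0 < \<tau>" for \<tau>
    unfolding A_def using that by measurable
  have mono: "A \<tau> \<subseteq> A \<tau>'" if "\<tau>' \<le> \<tau>" for \<tau> \<tau>'
  proof -
    have "ereal \<tau>' \<le> ereal \<tau>" using that by simp
    then show ?thesis unfolding A_def by (blast intro: order_trans)
  qed
  have UN: "(\<Union>n. A (1 / real (Suc n))) = V"
    unfolding V_def A_def step_path.visits_iff_ex_from[OF step_path_lam] by auto
  have "(\<lambda>n. prob (A (1 / real (Suc n)))) \<longlonglongrightarrow> prob (\<Union>n. A (1 / real (Suc n)))"
  proof (rule finite_Lim_measure_incseq)
    show "incseq (\<lambda>n. A (1 / real (Suc n)))"
      by (rule incseq_SucI, rule mono) (simp add: field_simps)
  qed (use A in auto)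
  then have lim: "(\<lambda>n. prob (A (1 / real (Suc n)))) \<longlonglongrightarrow> visit_integral (weight p)"
    unfolding UN by (simp add: V_def prob_visits)
  have le: "prob (A \<tau>) \<le> visit_integral (weight p)" if "0 < \<tau>" for \<tau>
  proof -
    have "0 < ereal \<tau>" using that by simp
    then have "A \<tau> \<subseteq> V" unfolding A_def V_def visits_def by (blast intro: less_le_trans)
    then show ?thesis unfolding prob_visits[symmetric] V_def[symmetric]
      by (rule finite_measure_mono) (simp add: V_def)
  qed
  have "((\<lambda>\<tau>. prob (A \<tau>)) \<longlongrightarrow> visit_integral (weight p)) (at_right 0)"
  proof (rule order_tendstoI)
    fix a assume "a < visit_integral (weight p)"
    then obtain n where n: "a < prob (A (1 / real (Suc n)))"
      using order_tendstoD(1)[OF lim] by (auto simp: eventually_sequentially)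
    have "a < prob (A \<tau>)" if "0 < \<tau>" "\<tau> < 1 / real (Suc n)" for \<tau>
    proof -
      have "prob (A (1 / real (Suc n))) \<le> prob (A \<tau>)"
        using that by (intro finite_measure_mono mono A) auto
      then show ?thesis using n by simp
    qed
    then show "\<forall>\<^sub>F \<tau> in at_right 0. a < prob (A \<tau>)"
      unfolding eventually_at_right_field by (intro exI[of _ "1 / real (Suc n)"]) simp
  next
    fix a assume "visit_integral (weight p) < a"
    then have "prob (A \<tau>) < a" if "0 < \<tau>" for \<tau> using le[OF that] by simp
    then show "\<forall>\<^sub>F \<tau> in at_right 0. prob (A \<tau>) < a"
      unfolding eventually_at_right_field by (intro exI[of _ 1]) simp
  qed
  then show ?thesis by (simp add: A_def)
qed

lemma partition_of_weight_exists: "\<exists>p. weight p = n"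
proof -
  have "finite {k. k \<ge> 1 \<and> (if k = 1 then n else 0) \<noteq> 0}"
    by (rule finite_subset[of _ "{1}"]) (auto split: if_splits)
  from part_counts_exist[OF this]
  obtain p where p: "\<forall>k\<ge>1. part_count k p = (if k = 1 then n else 0)" by blast
  have "b \<in> copies p \<longleftrightarrow> b \<in> {1} \<times> {1..n}" for b
    using p by (cases b; cases "fst b = 1") (auto simp: Suc_le_eq)
  then have "copies p = {1} \<times> {1..n}" by blast
  then have "weight p = (\<Sum>b\<in>{1::nat} \<times> {1..n}. fst b)" by (simp add: weight_eq_sum_copies)
  also have "\<dots> = (\<Sum>b\<in>{1::nat} \<times> {1..n}. 1::nat)" by (rule sum.cong) auto
  finally have "weight p = n" by simp
  then show ?thesis ..
qed

lemma visit_prob_eq: "visit_prob M \<epsilon> n = visit_integral n"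
  unfolding visit_prob_def
proof (rule the_equality)
  show "\<forall>p. weight p = n \<longrightarrow>
     ((\<lambda>\<tau>::real. prob {\<omega>\<in>space M. \<exists>t\<ge>ereal \<tau>. lam \<epsilon> \<omega> t = p}) \<longlongrightarrow> visit_integral n) (at_right 0)"
    using visit_prob_tendsto by blast
next
  fix y assume y: "\<forall>p. weight p = n \<longrightarrow>
     ((\<lambda>\<tau>::real. prob {\<omega>\<in>space M. \<exists>t\<ge>ereal \<tau>. lam \<epsilon> \<omega> t = p}) \<longlongrightarrow> y) (at_right 0)"
  obtain p where p: "weight p = n" using partition_of_weight_exists by blast
  show "y = visit_integral n"
    by (rule tendsto_unique[OF trivial_limit_at_right_real y[rule_format, OF p] visit_prob_tendsto[of p, unfolded p]])
qed

lemma backward_trans_adds: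
  assumes "adds_parts \<kappa> r \<mu> p"
  shows "backward_trans (visit_prob M \<epsilon>) \<mu> p =
    real \<kappa> / real (weight p) * visit_integral (weight p) / visit_integral (weight \<mu>)"
proof -
  have the: "(THE (\<kappa>, r). adds_parts \<kappa> r \<mu> p) = (\<kappa>, r)"
  proof (rule the_equality)
    fix z assume "case z of (\<kappa>, r) \<Rightarrow> adds_parts \<kappa> r \<mu> p"
    then have "adds_parts (fst z) (snd z) \<mu> p" by (simp add: split_def)
    from adds_parts_unique[OF assms this] show "z = (\<kappa>, r)" by (metis prod.collapse)
  qed (simp add: assms)
  show ?thesis
    unfolding backward_trans_def the Let_def visit_prob_eq
    using assms by (auto simp: weight_adds_parts[OF assms])
qed

lemma prob_preceded_by:
  "prob {\<omega>\<in>space M. preceded_by (lam \<epsilon> \<omega>) \<mu> p} =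
    visit_integral (weight \<mu>) * backward_trans (visit_prob M \<epsilon>) \<mu> p"
proof (cases "\<exists>\<kappa> r. adds_parts \<kappa> r \<mu> p")
  case True
  then obtain \<kappa> r where adds: "adds_parts \<kappa> r \<mu> p" by blast
  interpret adding_chain M \<epsilon> "\<lambda>i. if i = 0 then \<mu> else p" "\<lambda>_. \<kappa>" "\<lambda>_. r" 1
    by unfold_locales (simp add: adds)
  have "{\<omega>\<in>space M. preceded_by (lam \<epsilon> \<omega>) \<mu> p} =
      {\<omega>\<in>space M. visits (lam \<epsilon> \<omega>) p \<and> preceded_by (lam \<epsilon> \<omega>) \<mu> p}"
    by (auto simp: preceded_by_def)
  then have "prob {\<omega>\<in>space M. preceded_by (lam \<epsilon> \<omega>) \<mu> p} = real \<kappa> / real (weight p) * visit_integral (weight p)"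
    using prob_visits_races[of 1] by simp
  then show ?thesis using backward_trans_adds[OF adds] visit_integral_pos[of "weight \<mu>"] by simp
next
  case False
  have "AE \<omega> in M. \<not> preceded_by (lam \<epsilon> \<omega>) \<mu> p"
    using AE_typical
  proof eventually_elim
    case (elim \<omega>)
    show ?case using rings_first_if_preceded_by[OF elim, of \<mu> p] False by blast
  qed
  then have "prob {\<omega>\<in>space M. preceded_by (lam \<epsilon> \<omega>) \<mu> p} = 0"
    by (subst prob_Collect_eq_0) auto
  then show ?thesis using False by (simp add: backward_trans_def)
qed

end

lemma (in prob_space) has_sum_prob_partition:
  fixes D :: "'b :: countable \<Rightarrow> 'a set"
  assumes D: "\<And>x. D x \<in> events" and disj: "\<And>x y. x \<noteq> y \<Longrightarrow> D x \<inter> D y = {}"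
  shows "((\<lambda>x. prob (D x)) has_sum prob (\<Union>x. D x)) UNIV"
proof -
  define A where "A n = (if n \<in> range (to_nat :: 'b \<Rightarrow> nat) then D (from_nat n) else {})" for n
  have "disjoint_family A"
    unfolding disjoint_family_on_def
  proof (intro ballI impI)
    fix m n :: nat assume "m \<noteq> n"
    show "A m \<inter> A n = {}"
    proof (cases "m \<in> range (to_nat :: 'b \<Rightarrow> nat) \<and> n \<in> range (to_nat :: 'b \<Rightarrow> nat)")
      case True
      then obtain y z :: 'b where "m = to_nat y" "n = to_nat z" by blast
      then show ?thesis using disj[of y z] \<open>m \<noteq> n\<close> by (auto simp: A_def)
    qed (auto simp: A_def)
  qed
  moreover have "A n \<in> events" for n using D by (simp add: A_def)
  ultimately have "(\<lambda>n. prob (A n)) sums prob (\<Union>n. A n)"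
    by (intro finite_measure_UNION) auto
  then have "((\<lambda>n. prob (A n)) has_sum prob (\<Union>n. A n)) UNIV"
    by (rule sums_nonneg_imp_has_sum) simp
  also have "?this \<longleftrightarrow> ((\<lambda>n. prob (A n)) has_sum prob (\<Union>n. A n)) (range (to_nat :: 'b \<Rightarrow> nat))"
    by (rule has_sum_cong_neutral) (auto simp: A_def)
  also have "\<dots> \<longleftrightarrow> (((\<lambda>n. prob (A n)) \<circ> to_nat) has_sum prob (\<Union>n. A n)) (UNIV :: 'b set)"
    by (rule has_sum_reindex) simp
  also have "(\<Union>n. A n) = (\<Union>x. D x)" by (auto simp: A_def split: if_splits)
  finally show ?thesis by (simp add: comp_def A_def)
qed

context exponential_clocks
begin

lemma backward_trans_nonneg: "0 \<le> backward_trans (visit_prob M \<epsilon>) \<mu> p"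
  using prob_preceded_by[of \<mu> p] visit_integral_pos[of "weight \<mu>"]
  by (metis measure_nonneg zero_le_mult_iff not_le)

text \<open>Almost surely, a visited partition has exactly one predecessor, so the event of a visit to \<open>\<mu>\<close>
  is the disjoint union of the events in \<open>prob_preceded_by\<close>.\<close>

lemma has_sum_backward_trans: "(backward_trans (visit_prob M \<epsilon>) \<mu> has_sum 1) UNIV"
proof -
  let ?D = "\<lambda>p. {\<omega>\<in>space M. preceded_by (lam \<epsilon> \<omega>) \<mu> p}"
  have "((\<lambda>p. prob (?D p)) has_sum prob (\<Union>p. ?D p)) UNIV"
  proof (rule has_sum_prob_partition)
    fix p q :: int_partition assume "p \<noteq> q"
    then show "?D p \<inter> ?D q = {}"
      using step_path.preceded_by_right_unique[OF step_path_lam, of \<epsilon> _ \<mu> p q] by blast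
  qed simp
  also have "prob (\<Union>p. ?D p) = prob {\<omega>\<in>space M. visits (lam \<epsilon> \<omega>) \<mu>}"
  proof (rule measure_eq_AE)
    show "AE \<omega> in M. \<omega> \<in> (\<Union>p. ?D p) \<longleftrightarrow> \<omega> \<in> {\<omega>\<in>space M. visits (lam \<epsilon> \<omega>) \<mu>}"
      using AE_typical
    proof eventually_elim
      case (elim \<omega>)
      show ?case
        using unbounded_step_path.preceded_by_exists'[OF unbounded_step_path_lam[OF elim], of \<mu>]
        by (auto simp: preceded_by_def)
    qed
  qed auto
  finally have "((\<lambda>p. visit_integral (weight \<mu>) * backward_trans (visit_prob M \<epsilon>) \<mu> p)
      has_sum visit_integral (weight \<mu>)) UNIV"
    by (simp add: prob_preceded_by prob_visits)
  from has_sum_cmult_right[OF this, of "1 / visit_integral (weight \<mu>)"] visit_integral_pos[of "weight \<mu>"]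
  show ?thesis by simp
qed

lemma prob_backward_chain:
  assumes "x 0 = empty_partition"
  shows "prob {\<omega>\<in>space M. \<forall>i\<le>j. backward_chain (lam \<epsilon> \<omega>) i = x i} =
    prob {\<omega>\<in>space M. visits (lam \<epsilon> \<omega>) (x j) \<and> (\<forall>i<j. preceded_by (lam \<epsilon> \<omega>) (x i) (x (Suc i)))}"
proof (rule measure_eq_AE)
  show "AE \<omega> in M. \<omega> \<in> {\<omega>\<in>space M. \<forall>i\<le>j. backward_chain (lam \<epsilon> \<omega>) i = x i} \<longleftrightarrow>
    \<omega> \<in> {\<omega>\<in>space M. visits (lam \<epsilon> \<omega>) (x j) \<and> (\<forall>i<j. preceded_by (lam \<epsilon> \<omega>) (x i) (x (Suc i)))}"
    using AE_typical
  proof eventually_elim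
    case (elim \<omega>)
    interpret unbounded_step_path "lam \<epsilon> \<omega>" by (rule unbounded_step_path_lam[OF elim])
    have "visits (lam \<epsilon> \<omega>) (x j)" if "\<forall>i<j. preceded_by (lam \<epsilon> \<omega>) (x i) (x (Suc i))"
      using that assms by (cases j) (auto simp: preceded_by_def)
    then show ?case using backward_chain_eq_iff[of j x] assms by auto
  qed
qed measurable

lemma markov_chain_backward:
  "markov_chain M (\<lambda>j \<omega>. backward_chain (lam \<epsilon> \<omega>) j) empty_partition (backward_trans (visit_prob M \<epsilon>))"
  unfolding markov_chain_def
proof (intro conjI allI impI)
  show "AE \<omega> in M. backward_chain (lam \<epsilon> \<omega>) 0 = empty_partition"
    by (simp add: step_path.at_infty[OF step_path_lam])
next
  fix j x y
  let ?E = "\<lambda>j x. {\<omega>\<in>space M. \<forall>i\<le>j. backward_chain (lam \<epsilon> \<omega>) i = x i}"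
  let ?F = "\<lambda>j x. {\<omega>\<in>space M. visits (lam \<epsilon> \<omega>) (x j) \<and> (\<forall>i<j. preceded_by (lam \<epsilon> \<omega>) (x i) (x (Suc i)))}"
  assume pos: "0 < prob (?E j x)"
  have x0: "x 0 = empty_partition"
  proof (rule ccontr)
    assume "x 0 \<noteq> empty_partition"
    then have "?E j x = {}" by (auto simp: step_path.at_infty[OF step_path_lam] intro!: exI[of _ 0])
    then show False using pos by (simp only: measure_empty)
  qed
  have "\<exists>\<kappa> r. adds_parts \<kappa> r (x i) (x (Suc i))" if "i < j" for i
  proof (rule ccontr)
    assume "\<nexists>\<kappa> r. adds_parts \<kappa> r (x i) (x (Suc i))"
    then have "prob {\<omega>\<in>space M. preceded_by (lam \<epsilon> \<omega>) (x i) (x (Suc i))} = 0"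
      by (simp add: prob_preceded_by backward_trans_def)
    moreover have "prob (?F j x) \<le> prob {\<omega>\<in>space M. preceded_by (lam \<epsilon> \<omega>) (x i) (x (Suc i))}"
      using that by (intro finite_measure_mono) auto
    ultimately show False using pos unfolding prob_backward_chain[of x, OF x0] by simp
  qed
  then obtain \<kappa> r where adds: "\<And>i. i < j \<Longrightarrow> adds_parts (\<kappa> i) (r i) (x i) (x (Suc i))" by metis
  interpret C: adding_chain M \<epsilon> x \<kappa> r j by unfold_locales (rule adds)
  define Q where "Q = (\<Prod>i<j. real (\<kappa> i) / real (weight (x (Suc i))))"
  have E: "prob (?E j x) = Q * visit_integral (weight (x j))"
    unfolding prob_backward_chain[of x, OF x0] Q_def by (rule C.prob_visits_races) simp
  define x' where "x' = x(Suc j := y)"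
  have x'0: "x' 0 = empty_partition" using x0 by (simp add: x'_def)
  have "{\<omega>\<in>space M. backward_chain (lam \<epsilon> \<omega>) (Suc j) = y \<and> (\<forall>i\<le>j. backward_chain (lam \<epsilon> \<omega>) i = x i)} =
      ?E (Suc j) x'"
    by (auto simp: x'_def le_Suc_eq simp del: backward_chain.simps)
  then have cond: "cond_prob M (\<lambda>\<omega>. backward_chain (lam \<epsilon> \<omega>) (Suc j) = y) (\<lambda>\<omega>. \<forall>i\<le>j. backward_chain (lam \<epsilon> \<omega>) i = x i) =
      prob (?F (Suc j) x') / prob (?E j x)"
    unfolding cond_prob_def prob_backward_chain[of x', OF x'0, symmetric] by simp
  have "prob (?F (Suc j) x') = prob (?E j x) * backward_trans (visit_prob M \<epsilon>) (x j) y"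
  proof (cases "\<exists>k s. adds_parts k s (x j) y")
    case False
    have "prob (?F (Suc j) x') \<le> prob {\<omega>\<in>space M. preceded_by (lam \<epsilon> \<omega>) (x j) y}"
      by (intro finite_measure_mono) (auto simp: x'_def)
    also have "\<dots> = 0" using False by (simp add: prob_preceded_by backward_trans_def)
    finally have "prob (?F (Suc j) x') = 0" by (simp add: measure_le_0_iff)
    then show ?thesis using False by (simp add: backward_trans_def)
  next
    case True
    then obtain k s where ks: "adds_parts k s (x j) y" by blast
    interpret C': adding_chain M \<epsilon> x' "\<kappa>(j := k)" "r(j := s)" "Suc j"
      by unfold_locales (use adds ks in \<open>auto simp: x'_def less_Suc_eq\<close>)
    have "prob (?F (Suc j) x') =
      (\<Prod>i<Suc j. real ((\<kappa>(j := k)) i) / real (weight (x' (Suc i)))) * visit_integral (weight y)"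
      using C'.prob_visits_races[of "Suc j"] by (simp add: x'_def)
    also have "(\<Prod>i<Suc j. real ((\<kappa>(j := k)) i) / real (weight (x' (Suc i)))) = Q * (real k / real (weight y))"
      by (simp add: Q_def x'_def)
    finally show ?thesis
      using visit_integral_pos[of "weight (x j)"] unfolding E backward_trans_adds[OF ks] by simp
  qed
  then show "cond_prob M (\<lambda>\<omega>. backward_chain (lam \<epsilon> \<omega>) (Suc j) = y) (\<lambda>\<omega>. \<forall>i\<le>j. backward_chain (lam \<epsilon> \<omega>) i = x i) =
      backward_trans (visit_prob M \<epsilon>) (x j) y"
    unfolding cond using pos by simp
qed (rule backward_trans_nonneg has_sum_backward_trans measurable_backward_chain)+

end

theorem theorem3p5:
  fixes M :: "'a measure" and \<epsilon> :: "nat \<Rightarrow> nat \<Rightarrow> 'a \<Rightarrow> real"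
  assumes "prob_space M"
    and "prob_space.indep_vars M (\<lambda>_. borel) (\<lambda>(k, j). \<epsilon> k j) ({1..} \<times> {1..})"
    and "\<And>k j. k \<ge> 1 \<Longrightarrow> j \<ge> 1 \<Longrightarrow> distributed M lborel (\<epsilon> k j) (exponential_density 1)"
  shows "(\<forall>m. AE \<omega> in M.
           limitin (discrete_topology UNIV)
             (\<lambda>\<tau>::real. map (reversed_chain (lam \<epsilon> \<omega>) (ereal \<tau>)) [0..<Suc m])
             (map (backward_chain (lam \<epsilon> \<omega>)) [0..<Suc m])
             (at_right 0)) \<and>
         markov_chain M (\<lambda>j \<omega>. backward_chain (lam \<epsilon> \<omega>) j) empty_partition
           (backward_trans (visit_prob M \<epsilon>))"
proof -
  interpret exponential_clocks M \<epsilon>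
    using assms by (simp add: exponential_clocks_def exponential_clocks_axioms_def)
  have "AE \<omega> in M. limitin (discrete_topology UNIV)
             (\<lambda>\<tau>::real. map (reversed_chain (lam \<epsilon> \<omega>) (ereal \<tau>)) [0..<Suc m])
             (map (backward_chain (lam \<epsilon> \<omega>)) [0..<Suc m]) (at_right 0)" for m
    using AE_typical
    by eventually_elim (intro unbounded_step_path.reversed_chain_limit unbounded_step_path_lam)
  then show ?thesis using markov_chain_backward by blast
qed

end
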